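(* Let $\Omega\subset\mathbb{R}^n$, $n\ge 3$, be a domain. The following conditions are equivalent. (i) The family $\mathrm{CH}(\mathbb{D},\Omega)$ of conformal harmonic discs $\mathbb{D}\to\Omega$ is pointwise equicontinuous for some metric $\rho$ on $\Omega$ inducing the natural topology. (ii) The family $\mathrm{CH}(\mathbb{D},\Omega)$ is an even family. (iii) The domain $\Omega$ is R-hyperbolic. (iv) The domain $\Omega$ is hyperbolic. (v) The distance function $\rho_\Omega$ induces the topology of $\Omega$.
   Context: A domain is a nonempty connected open set. $\mathbb{D}=\{z=x+iy\in\mathbb{C}:|z|<1\}$. A $C^1$ map $f$ from an open subset of $\mathbb{R}^2=\mathbb{C}$ to $\mathbb{R}^n$ is conformal if $|f_x|=|f_y|$ and $f_x\cdot f_y=0$ at every point (it need not be an immersion). $\mathrm{CH}(\mathbb{D},\Omega)$ denotes the set of all conformal harmonic maps $\mathbb{D}\to\Omega$. Minimal pseudometric: for $\mathbf{x}\in\Omega$, $\mathbf{v}\in\mathbb{R}^n$, $$g_\Omega(\mathbf{x},\mathbf{v})=\inf\{1/r>0:\exists f\in \mathrm{CH}(\mathbb{D},\Omega),\ f(0)=\mathbf{x},\ f_x(0)=r\mathbf{v}\}.$$ Minimal pseudodistance: $\rho_\Omega(\mathbf{x},\mathbf{y})=\inf_\gamma\int_0^1 g_\Omega(\gamma(t),\dot\gamma(t))\,dt$, the infimum over all piecewise smooth paths $\gamma:[0,1]\to\Omega$ from $\mathbf{x}$ to $\mathbf{y}$. $\Omega$ is hyperbolic if $\rho_\Omega(\mathbf{x},\mathbf{y})>0$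 for any pair of distinct points $\mathbf{x},\mathbf{y}\in\Omega$. $\Omega$ is hyperbolic at a point $\mathbf{p}\in\Omega$ if there are a neighbourhood $U\subset\Omega$ of $\mathbf{p}$ and a constant $c>0$ such that $g_\Omega(\mathbf{x},\mathbf{u})\ge c|\mathbf{u}|$ for all $\mathbf{x}\in U$ and $\mathbf{u}\in\mathbb{R}^n$. $\Omega$ is R-hyperbolic if it is hyperbolic at every point of $\Omega$. A family $\mathscr{F}$ of maps from a topological space $X$ to a topological space $Y$ is an even family if, given points $x\in X$ and $y\in Y$ and a neighbourhood $U\subset Y$ of $y$, there are a neighbourhood $V\subset X$ of $x$ and a neighbourhood $W\subset U$ of $y$ such that for every $f\in\mathscr{F}$ with $f(x)\in W$ we have $f(V)\subset U$. *)

theory Defs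
  imports "HOL-Analysis.Analysis"
begin

section \<open>Conformal harmonic discs\<close>

text \<open>
  The domains of the maps below are open subsets of the plane, identified with \<^typ>\<open>complex\<close>.
  \<open>dx f\<close> and \<open>dy f\<close> are the partial derivatives $f_x$, $f_y$; they are meaningful at points
  where \<open>f\<close> is differentiable in the real sense, which is part of \<open>C1_map_on\<close>. Only the values of a
  map on the given open set are relevant.
\<close>

definition dx :: "(complex \<Rightarrow> 'a::real_normed_vector) \<Rightarrow> complex \<Rightarrow> 'a" where
  "dx f z = frechet_derivative f (at z) 1"

definition dy :: "(complex \<Rightarrow> 'a::real_normed_vector) \<Rightarrow> complex \<Rightarrow> 'a" where
  "dy f z = frechet_derivative f (at z) \<i>"

definition C1_map_on :: "complex set \<Rightarrow> (complex \<Rightarrow> 'a::real_normed_vector) \<Rightarrow> bool" where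
  "C1_map_on S f \<longleftrightarrow>
     (\<forall>z\<in>S. f differentiable at z) \<and> continuous_on S (dx f) \<and> continuous_on S (dy f)"

definition C2_map_on :: "complex set \<Rightarrow> (complex \<Rightarrow> 'a::real_normed_vector) \<Rightarrow> bool" where
  "C2_map_on S f \<longleftrightarrow> C1_map_on S f \<and> C1_map_on S (dx f) \<and> C1_map_on S (dy f)"

definition harmonic_map_on :: "complex set \<Rightarrow> (complex \<Rightarrow> 'a::real_normed_vector) \<Rightarrow> bool" where
  "harmonic_map_on S f \<longleftrightarrow> C2_map_on S f \<and> (\<forall>z\<in>S. dx (dx f) z + dy (dy f) z = 0)"

definition conformal_map_on :: "complex set \<Rightarrow> (complex \<Rightarrow> 'a::real_inner) \<Rightarrow> bool" where
  "conformal_map_on S f \<longleftrightarrow>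
     C1_map_on S f \<and> (\<forall>z\<in>S. norm (dx f z) = norm (dy f z) \<and> dx f z \<bullet> dy f z = 0)"

abbreviation unit_disc :: "complex set" where
  "unit_disc \<equiv> ball 0 1"

definition CH :: "complex set \<Rightarrow> 'a::real_inner set \<Rightarrow> (complex \<Rightarrow> 'a) set" where
  "CH S \<Omega> = {f. conformal_map_on S f \<and> harmonic_map_on S f \<and> f ` S \<subseteq> \<Omega>}"


section \<open>The minimal pseudometric and pseudodistance\<close>

text \<open>
  For open \<open>\<Omega>\<close> of dimension at least 2 and \<open>x \<in> \<Omega>\<close> the set below is nonempty (small flat discs),
  so the real infimum is the true one.
\<close>

definition minimal_metric :: "'a::euclidean_space set \<Rightarrow> 'a \<Rightarrow> 'a \<Rightarrow> real" where
  "minimal_metric \<Omega> x v =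
     Inf {1 / r | r. r > 0 \<and> (\<exists>f \<in> CH unit_disc \<Omega>. f 0 = x \<and> dx f 0 = r *\<^sub>R v)}"

text \<open>
  The integrand is nonnegative, and it is measurable since the minimal pseudometric is upper
  semicontinuous, so its integral is taken in \<^typ>\<open>ennreal\<close>. The infimum is finite whenever \<open>x\<close>
  and \<open>y\<close> can be joined in \<open>\<Omega>\<close>. Paths are piecewise $C^1$; the finitely many parameters at which the
  derivative need not exist do not contribute to the integral.
\<close>

definition minimal_dist :: "'a::euclidean_space set \<Rightarrow> 'a \<Rightarrow> 'a \<Rightarrow> ennreal" where
  "minimal_dist \<Omega> x y =
     (INF \<gamma> \<in> {\<gamma>. valid_path \<gamma> \<and> path_image \<gamma> \<subseteq> \<Omega> \<and> pathstart \<gamma> = x \<and> pathfinish \<gamma> = y}.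
        \<integral>\<^sup>+t\<in>{0..1}. ennreal (minimal_metric \<Omega> (\<gamma> t) (vector_derivative \<gamma> (at t within {0..1}))) \<partial>lborel)"

definition hyperbolic :: "'a::euclidean_space set \<Rightarrow> bool" where
  "hyperbolic \<Omega> \<longleftrightarrow> (\<forall>x\<in>\<Omega>. \<forall>y\<in>\<Omega>. x \<noteq> y \<longrightarrow> minimal_dist \<Omega> x y > 0)"

definition hyperbolic_at :: "'a::euclidean_space set \<Rightarrow> 'a \<Rightarrow> bool" where
  "hyperbolic_at \<Omega> p \<longleftrightarrow>
     (\<exists>U c. open U \<and> p \<in> U \<and> U \<subseteq> \<Omega> \<and> c > 0 \<and>
        (\<forall>x\<in>U. \<forall>u. minimal_metric \<Omega> x u \<ge> c * norm u))"

definition R_hyperbolic :: "'a::euclidean_space set \<Rightarrow> bool" where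
  "R_hyperbolic \<Omega> \<longleftrightarrow> (\<forall>p\<in>\<Omega>. hyperbolic_at \<Omega> p)"

text \<open>
  The topology on \<open>S\<close> generated by the balls of a pseudodistance \<open>d\<close> is the subspace topology.
  (The library's \<open>Metric_space.mtopology\<close> presupposes that \<open>d\<close> is a finite metric.)
\<close>

definition induces_topology_on :: "'a::topological_space set \<Rightarrow> ('a \<Rightarrow> 'a \<Rightarrow> ennreal) \<Rightarrow> bool" where
  "induces_topology_on S d \<longleftrightarrow>
     (\<forall>U. openin (top_of_set S) U \<longleftrightarrow>
            U \<subseteq> S \<and> (\<forall>x\<in>U. \<exists>e>0. {y \<in> S. d x y < e} \<subseteq> U))"


section \<open>Families of maps\<close>

definition pointwise_equicontinuous_on ::
    "'a::metric_space set \<Rightarrow> ('b \<Rightarrow> 'b \<Rightarrow> real) \<Rightarrow> ('a \<Rightarrow> 'b) set \<Rightarrow> bool" where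
  "pointwise_equicontinuous_on S d F \<longleftrightarrow>
     (\<forall>x\<in>S. \<forall>e>0. \<exists>\<delta>>0. \<forall>f\<in>F. \<forall>y\<in>S. dist x y < \<delta> \<longrightarrow> d (f x) (f y) < e)"

text \<open>Neighbourhoods are taken to be open, which gives the same notion.\<close>

definition even_family :: "'a topology \<Rightarrow> 'b topology \<Rightarrow> ('a \<Rightarrow> 'b) set \<Rightarrow> bool" where
  "even_family X Y F \<longleftrightarrow>
     (\<forall>x \<in> topspace X. \<forall>y \<in> topspace Y. \<forall>U. openin Y U \<and> y \<in> U \<longrightarrow>
        (\<exists>V W. openin X V \<and> x \<in> V \<and> openin Y W \<and> y \<in> W \<and> W \<subseteq> U \<and>
           (\<forall>f\<in>F. f x \<in> W \<longrightarrow> f ` V \<subseteq> U)))"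

end

theory Submission
  imports Defs "HOL-Complex_Analysis.Cauchy_Integral_Formula"
begin

text \<open>
  The implications are (i) \<open>\<Longrightarrow>\<close> (ii) \<open>\<Longrightarrow>\<close> (iii) \<open>\<Longrightarrow>\<close> (i) and (iii) \<open>\<Longrightarrow>\<close> (v) \<open>\<Longrightarrow>\<close> (iv) \<open>\<Longrightarrow>\<close> (iii).
  If all discs centred near \<open>p\<close> map a fixed disc around the origin into a small ball, the gradient
  estimate for harmonic functions bounds \<open>dx f 0\<close>, which is hyperbolicity at \<open>p\<close>; an even family has
  this property by definition. If it fails on a hyperbolic domain, there are discs \<open>F n\<close> with
  \<open>F n 0 \<longlonglongrightarrow> p\<close> and points \<open>Z n \<longlonglongrightarrow> 0\<close> with \<open>F n (Z n)\<close> converging to some \<open>q \<noteq> p\<close>; the image of the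
  segment from \<open>0\<close> to \<open>Z n\<close> has small \<open>g\<close>-length, so the pseudodistance of \<open>p\<close> and \<open>q\<close> vanishes.
  Conversely, a lower bound \<open>g \<ge> c |u|\<close> near a point bounds from below the length of every path leaving
  a small ball around it, while flat discs bound distances from above, so the pseudodistance
  induces the topology.

  The metric in (i) need not be the minimal distance, whose triangle inequality would require
  measurability of \<open>g\<close> along paths. It is replaced by
  \<open>SUP u. |u x - u y|\<close> over functions \<open>u\<close> with values in \<open>[0, 1]\<close> that do not increase distances along
  discs: discs are equicontinuous for it by construction, and R-hyperbolicity makes truncated multiples
  of the Euclidean distance from a point admissible, so that it induces the topology.
\<close>

section \<open>Partial derivatives\<close>

lemma has_derivative_dx_dy:
  assumes "f differentiable at z"
  shows "(f has_derivative (\<lambda>w. Re w *\<^sub>R dx f z + Im w *\<^sub>R dy f z)) (at z)"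
proof -
  have D: "(f has_derivative frechet_derivative f (at z)) (at z)"
    using assms frechet_derivative_works by blast
  then have lin: "linear (frechet_derivative f (at z))"
    using has_derivative_linear by blast
  have "frechet_derivative f (at z) w = Re w *\<^sub>R dx f z + Im w *\<^sub>R dy f z" for w
  proof -
    have "w = Re w *\<^sub>R 1 + Im w *\<^sub>R \<i>"
      by (simp add: complex_eq_iff)
    then have "frechet_derivative f (at z) w = frechet_derivative f (at z) (Re w *\<^sub>R 1 + Im w *\<^sub>R \<i>)"
      by simp
    also have "\<dots> = Re w *\<^sub>R dx f z + Im w *\<^sub>R dy f z"
      unfolding dx_def dy_def by (simp only: linear_add[OF lin] linear_cmul[OF lin])
    finally show ?thesis .
  qed
  then show ?thesis using D by presburger
qed

lemma dx_dy_eqI: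
  assumes "(f has_derivative D) (at z)"
  shows "dx f z = D 1" and "dy f z = D \<i>"
  using frechet_derivative_at[OF assms] by (auto simp: dx_def dy_def)

text \<open>Uniqueness of the Frechet derivative turns a guessed linear form into regularity and
  both partial derivatives at once; the calculus rules below are obtained by guessing
  \<open>p\<close> and \<open>q\<close>.\<close>

lemma C1_map_onI:
  assumes "\<And>z. z \<in> S \<Longrightarrow> (f has_derivative (\<lambda>w. Re w *\<^sub>R p z + Im w *\<^sub>R q z)) (at z)"
    and "continuous_on S p" and "continuous_on S q"
  shows "C1_map_on S f" and "\<And>z. z \<in> S \<Longrightarrow> dx f z = p z" and "\<And>z. z \<in> S \<Longrightarrow> dy f z = q z"
proof -
  show p: "\<And>z. z \<in> S \<Longrightarrow> dx f z = p z" and q: "\<And>z. z \<in> S \<Longrightarrow> dy f z = q z"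
    using dx_dy_eqI[OF assms(1)] by auto
  show "C1_map_on S f"
    unfolding C1_map_on_def
    using assms p q by (auto simp: differentiable_def cong: continuous_on_cong)
qed

text \<open>Formulas for \<open>dx f\<close> and \<open>dy f\<close> hold only on the given open
  set, so differentiating them once more goes through this transfer.\<close>

lemma C1_map_on_cong:
  assumes "open S" and eq: "\<forall>z\<in>S. f z = g z" and f: "C1_map_on S f"
  shows "C1_map_on S g" and "\<And>z. z \<in> S \<Longrightarrow> dx g z = dx f z" and "\<And>z. z \<in> S \<Longrightarrow> dy g z = dy f z"
proof -
  have D: "(g has_derivative (\<lambda>w. Re w *\<^sub>R dx f z + Im w *\<^sub>R dy f z)) (at z)" if "z \<in> S" for z
  proof (rule has_derivative_transform_within_open[OF has_derivative_dx_dy \<open>open S\<close> that])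
    show "f differentiable at z"
      using f that by (simp add: C1_map_on_def)
  qed (use eq in auto)
  have c: "continuous_on S (dx f)" "continuous_on S (dy f)"
    using f by (auto simp: C1_map_on_def)
  show "C1_map_on S g" "\<And>z. z \<in> S \<Longrightarrow> dx g z = dx f z" "\<And>z. z \<in> S \<Longrightarrow> dy g z = dy f z"
    using C1_map_onI[where p="dx f" and q="dy f", OF D c] by auto
qed

lemma C1_map_on_imp_continuous_on: "C1_map_on S f \<Longrightarrow> continuous_on S f"
  unfolding C1_map_on_def
  by (meson continuous_at_imp_continuous_on differentiable_imp_continuous_within)

lemma C1_map_on_const: "C1_map_on S (\<lambda>z. c)"
  and dx_const: "dx (\<lambda>z. c) = (\<lambda>z. 0)" and dy_const: "dy (\<lambda>z. c) = (\<lambda>z. 0)"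
proof -
  have "((\<lambda>z. c) has_derivative (\<lambda>w. Re w *\<^sub>R 0 + Im w *\<^sub>R 0)) (at z)" for z
    by simp
  from C1_map_onI[OF this] show "C1_map_on S (\<lambda>z. c)" by simp
  show "dx (\<lambda>z. c) = (\<lambda>z. 0)" "dy (\<lambda>z. c) = (\<lambda>z. 0)"
    by (auto simp: dx_def dy_def)
qed

text \<open>Multiplication by \<open>b\<close> is the real matrix with rows (Re b, -Im b) and (Im b,
  Re b); its columns, the images of 1 and i, give the coefficients in the two formulas.\<close>

lemma C1_map_on_affine:
  assumes f: "C1_map_on T f" and sub: "(\<lambda>w. a + b * w) ` S \<subseteq> T"
  shows "C1_map_on S (\<lambda>w. f (a + b * w))"
    and "\<And>w. w \<in> S \<Longrightarrow> dx (\<lambda>w. f (a + b * w)) w = Re b *\<^sub>R dx f (a + b * w) + Im b *\<^sub>R dy f (a + b * w)"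
    and "\<And>w. w \<in> S \<Longrightarrow> dy (\<lambda>w. f (a + b * w)) w = Re b *\<^sub>R dy f (a + b * w) - Im b *\<^sub>R dx f (a + b * w)"
proof -
  let ?p = "\<lambda>w. Re b *\<^sub>R dx f (a + b * w) + Im b *\<^sub>R dy f (a + b * w)"
  let ?q = "\<lambda>w. Re b *\<^sub>R dy f (a + b * w) - Im b *\<^sub>R dx f (a + b * w)"
  have D: "((\<lambda>w. f (a + b * w)) has_derivative (\<lambda>v. Re v *\<^sub>R ?p w + Im v *\<^sub>R ?q w)) (at w)"
    if "w \<in> S" for w
  proof -
    have 1: "((\<lambda>w. a + b * w) has_derivative (\<lambda>v. b * v)) (at w)"
      by (auto intro!: derivative_eq_intros)
    have "f differentiable at (a + b * w)"
      using f sub that by (auto simp: C1_map_on_def)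
    from has_derivative_compose[OF 1 has_derivative_dx_dy[OF this]]
    show ?thesis by (simp add: algebra_simps)
  qed
  have "continuous_on S (\<lambda>w. h (a + b * w))" if "continuous_on T h" for h :: "complex \<Rightarrow> 'a"
    by (rule continuous_on_compose2[OF that]) (use sub in \<open>auto intro!: continuous_intros\<close>)
  then have c: "continuous_on S ?p" "continuous_on S ?q"
    using f by (auto simp: C1_map_on_def intro!: continuous_intros)
  show "C1_map_on S (\<lambda>w. f (a + b * w))"
    "\<And>w. w \<in> S \<Longrightarrow> dx (\<lambda>w. f (a + b * w)) w = ?p w"
    "\<And>w. w \<in> S \<Longrightarrow> dy (\<lambda>w. f (a + b * w)) w = ?q w"
    using C1_map_onI[where p="?p" and q="?q", OF D c] by auto
qed

lemma C1_map_on_linear_combination: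
  assumes f: "C1_map_on S f" and g: "C1_map_on S g"
  shows "C1_map_on S (\<lambda>w. \<alpha> *\<^sub>R f w + \<beta> *\<^sub>R g w)"
    and "\<And>w. w \<in> S \<Longrightarrow> dx (\<lambda>w. \<alpha> *\<^sub>R f w + \<beta> *\<^sub>R g w) w = \<alpha> *\<^sub>R dx f w + \<beta> *\<^sub>R dx g w"
    and "\<And>w. w \<in> S \<Longrightarrow> dy (\<lambda>w. \<alpha> *\<^sub>R f w + \<beta> *\<^sub>R g w) w = \<alpha> *\<^sub>R dy f w + \<beta> *\<^sub>R dy g w"
proof -
  let ?p = "\<lambda>w. \<alpha> *\<^sub>R dx f w + \<beta> *\<^sub>R dx g w"
  let ?q = "\<lambda>w. \<alpha> *\<^sub>R dy f w + \<beta> *\<^sub>R dy g w"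
  have D: "((\<lambda>w. \<alpha> *\<^sub>R f w + \<beta> *\<^sub>R g w) has_derivative (\<lambda>v. Re v *\<^sub>R ?p w + Im v *\<^sub>R ?q w)) (at w)"
    if "w \<in> S" for w
  proof -
    have "f differentiable at w" "g differentiable at w"
      using f g that by (simp_all add: C1_map_on_def)
    note has_derivative_add[OF has_derivative_scaleR_right[OF has_derivative_dx_dy[OF this(1)]]
        has_derivative_scaleR_right[OF has_derivative_dx_dy[OF this(2)]]]
    from this[of \<alpha> \<beta>] show ?thesis by (simp add: algebra_simps)
  qed
  have c: "continuous_on S ?p" "continuous_on S ?q"
    using f g by (auto simp: C1_map_on_def intro!: continuous_intros)
  show "C1_map_on S (\<lambda>w. \<alpha> *\<^sub>R f w + \<beta> *\<^sub>R g w)"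
    "\<And>w. w \<in> S \<Longrightarrow> dx (\<lambda>w. \<alpha> *\<^sub>R f w + \<beta> *\<^sub>R g w) w = ?p w"
    "\<And>w. w \<in> S \<Longrightarrow> dy (\<lambda>w. \<alpha> *\<^sub>R f w + \<beta> *\<^sub>R g w) w = ?q w"
    using C1_map_onI[where p="?p" and q="?q", OF D c] by auto
qed

lemma C1_map_on_inner:
  fixes f :: "complex \<Rightarrow> 'a::real_inner"
  assumes f: "C1_map_on S f"
  shows "C1_map_on S (\<lambda>w. f w \<bullet> e)"
    and "\<And>w. w \<in> S \<Longrightarrow> dx (\<lambda>w. f w \<bullet> e) w = dx f w \<bullet> e"
    and "\<And>w. w \<in> S \<Longrightarrow> dy (\<lambda>w. f w \<bullet> e) w = dy f w \<bullet> e"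
proof -
  have D: "((\<lambda>w. f w \<bullet> e) has_derivative (\<lambda>v. Re v *\<^sub>R (dx f w \<bullet> e) + Im v *\<^sub>R (dy f w \<bullet> e))) (at w)"
    if "w \<in> S" for w
  proof -
    have "f differentiable at w"
      using f that by (simp add: C1_map_on_def)
    from has_derivative_inner_left[OF has_derivative_dx_dy[OF this], of e]
    show ?thesis by (simp add: inner_add_left)
  qed
  have c: "continuous_on S (\<lambda>w. dx f w \<bullet> e)" "continuous_on S (\<lambda>w. dy f w \<bullet> e)"
    using f by (auto simp: C1_map_on_def intro!: continuous_intros)
  show "C1_map_on S (\<lambda>w. f w \<bullet> e)"
    "\<And>w. w \<in> S \<Longrightarrow> dx (\<lambda>w. f w \<bullet> e) w = dx f w \<bullet> e"
    "\<And>w. w \<in> S \<Longrightarrow> dy (\<lambda>w. f w \<bullet> e) w = dy f w \<bullet> e"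
    using C1_map_onI[OF D c] by auto
qed

section \<open>Reparametrized and flat discs\<close>

lemma harmonic_map_on_inner:
  fixes f :: "complex \<Rightarrow> 'a::real_inner"
  assumes "open S" and f: "harmonic_map_on S f"
  shows "harmonic_map_on S (\<lambda>w. f w \<bullet> e)"
proof -
  have C: "C1_map_on S f" "C1_map_on S (dx f)" "C1_map_on S (dy f)"
    and L: "\<And>z. z \<in> S \<Longrightarrow> dx (dx f) z + dy (dy f) z = 0"
    using f by (auto simp: harmonic_map_on_def C2_map_on_def)
  have x: "\<forall>w\<in>S. dx f w \<bullet> e = dx (\<lambda>w. f w \<bullet> e) w" and y: "\<forall>w\<in>S. dy f w \<bullet> e = dy (\<lambda>w. f w \<bullet> e) w"
    using C1_map_on_inner[OF C(1)] by auto
  note x = C1_map_on_cong[OF \<open>open S\<close> x C1_map_on_inner(1)[OF C(2)]]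
    and y = C1_map_on_cong[OF \<open>open S\<close> y C1_map_on_inner(1)[OF C(3)]]
  show ?thesis
    unfolding harmonic_map_on_def C2_map_on_def
    using x y C1_map_on_inner[OF C(1)] C1_map_on_inner[OF C(2)] C1_map_on_inner[OF C(3)] L
    by (auto simp flip: inner_add_left)
qed

text \<open>The substitution multiplies the Laplacian by |b|^2 and sends an orthogonal pair
  \<open>dx f\<close>, \<open>dy f\<close> of equal lengths to another such pair. The case
  \<open>b = 0\<close> is allowed and gives constant discs.\<close>

lemma CH_affine:
  assumes f: "f \<in> CH T \<Omega>" and "open S" and sub: "(\<lambda>w. a + b * w) ` S \<subseteq> T"
  shows "(\<lambda>w. f (a + b * w)) \<in> CH S \<Omega>"
proof -
  let ?g = "\<lambda>w. f (a + b * w)"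
  have C: "C1_map_on T f" "C1_map_on T (dx f)" "C1_map_on T (dy f)"
    and L: "\<And>z. z \<in> T \<Longrightarrow> dx (dx f) z + dy (dy f) z = 0"
    and N: "\<And>z. z \<in> T \<Longrightarrow> norm (dx f z) = norm (dy f z) \<and> dx f z \<bullet> dy f z = 0"
    and im: "f ` T \<subseteq> \<Omega>"
    using f by (auto simp: CH_def harmonic_map_on_def C2_map_on_def conformal_map_on_def)
  note A = C1_map_on_affine[OF C(1) sub] and Ax = C1_map_on_affine[OF C(2) sub]
    and Ay = C1_map_on_affine[OF C(3) sub]
  note X = C1_map_on_linear_combination[OF Ax(1) Ay(1), where \<alpha>="Re b" and \<beta>="Im b"]
    and Y = C1_map_on_linear_combination[OF Ay(1) Ax(1), where \<alpha>="Re b" and \<beta>="- Im b"]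
  have x: "\<forall>w\<in>S. Re b *\<^sub>R dx f (a + b * w) + Im b *\<^sub>R dy f (a + b * w) = dx ?g w"
    and y: "\<forall>w\<in>S. Re b *\<^sub>R dy f (a + b * w) + (- Im b) *\<^sub>R dx f (a + b * w) = dy ?g w"
    using A(2,3) by auto
  note cx = C1_map_on_cong[OF \<open>open S\<close> x X(1)]
    and cy = C1_map_on_cong[OF \<open>open S\<close> y Y(1)]
  have "dx (dx ?g) w + dy (dy ?g) w = 0" if "w \<in> S" for w
  proof -
    have "dx (dx ?g) w = Re b *\<^sub>R dx (\<lambda>w. dx f (a + b * w)) w + Im b *\<^sub>R dx (\<lambda>w. dy f (a + b * w)) w"
      and "dy (dy ?g) w = Re b *\<^sub>R dy (\<lambda>w. dy f (a + b * w)) w + (- Im b) *\<^sub>R dy (\<lambda>w. dx f (a + b * w)) w"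
      unfolding cx(2)[OF that] cy(3)[OF that] X(2)[OF that] Y(3)[OF that] by simp_all
    \<comment> \<open>Each mixed derivative occurs twice with opposite signs; the pure ones combine
      to the Laplacian.\<close>
    then have "dx (dx ?g) w + dy (dy ?g) w
        = ((Re b)\<^sup>2 + (Im b)\<^sup>2) *\<^sub>R (dx (dx f) (a + b * w) + dy (dy f) (a + b * w))"
      unfolding Ax(2)[OF that] Ax(3)[OF that] Ay(2)[OF that] Ay(3)[OF that]
      by (simp add: algebra_simps power2_eq_square)
    moreover have "dx (dx f) (a + b * w) + dy (dy f) (a + b * w) = 0"
      using L sub that by blast
    ultimately show ?thesis by simp
  qed
  moreover have "norm (dx ?g w) = norm (dy ?g w) \<and> dx ?g w \<bullet> dy ?g w = 0" if "w \<in> S" for w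
  proof -
    let ?p = "dx f (a + b * w)" and ?q = "dy f (a + b * w)"
    have "norm ?p = norm ?q" and o: "?p \<bullet> ?q = 0"
      using N sub that by blast+
    then have n: "?p \<bullet> ?p = ?q \<bullet> ?q"
      by (simp add: norm_eq)
    have g: "dx ?g w = Re b *\<^sub>R ?p + Im b *\<^sub>R ?q" "dy ?g w = Re b *\<^sub>R ?q - Im b *\<^sub>R ?p"
      using A(2,3) that by auto
    have "dx ?g w \<bullet> dx ?g w = dy ?g w \<bullet> dy ?g w" "dx ?g w \<bullet> dy ?g w = 0"
      unfolding g using n o
      by (simp_all add: inner_add_left inner_add_right inner_diff_left inner_diff_right inner_commute)
    then show ?thesis by (simp add: norm_eq)
  qed
  moreover have "?g ` S \<subseteq> \<Omega>"
    using im sub by (simp add: image_subset_iff)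
  ultimately show ?thesis
    using A(1) cx(1) cy(1)
    unfolding CH_def harmonic_map_on_def C2_map_on_def conformal_map_on_def by auto
qed

lemma flat_map_in_CH:
  assumes "norm v = norm w" and "v \<bullet> w = 0"
    and im: "(\<lambda>z. x + Re z *\<^sub>R v + Im z *\<^sub>R w) ` S \<subseteq> \<Omega>"
  shows "(\<lambda>z. x + Re z *\<^sub>R v + Im z *\<^sub>R w) \<in> CH S \<Omega>"
    and "dx (\<lambda>z. x + Re z *\<^sub>R v + Im z *\<^sub>R w) = (\<lambda>z. v)"
    and "dy (\<lambda>z. x + Re z *\<^sub>R v + Im z *\<^sub>R w) = (\<lambda>z. w)"
proof -
  let ?f = "\<lambda>z. x + Re z *\<^sub>R v + Im z *\<^sub>R w"
  have D: "(?f has_derivative (\<lambda>h. Re h *\<^sub>R v + Im h *\<^sub>R w)) (at z)" for z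
    by (auto intro!: derivative_eq_intros)
  show e: "dx ?f = (\<lambda>z. v)" "dy ?f = (\<lambda>z. w)"
    using dx_dy_eqI[OF D] by auto
  have "C1_map_on S ?f"
    using C1_map_onI(1)[OF D] by auto
  then show "?f \<in> CH S \<Omega>"
    using assms
    by (auto simp: CH_def harmonic_map_on_def C2_map_on_def conformal_map_on_def e
        C1_map_on_const dx_const dy_const)
qed

section \<open>Gradient estimate for harmonic functions\<close>

text \<open>Two applications of the mean value theorem, first in direction \<open>p\<close> to a
  difference of values of \<open>u\<close>, then in direction \<open>q\<close> to \<open>up\<close>.
  Abstract directions allow using it with 1 and i in both orders.\<close>

lemma second_difference_mean_value:
  fixes u :: "complex \<Rightarrow> real"
  assumes "h > 0"
    and p: "\<And>s t. s \<in> {0..h} \<Longrightarrow> t \<in> {0..h} \<Longrightarrow>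
        ((\<lambda>s. u (z + of_real s * p + of_real t * q)) has_real_derivative up (z + of_real s * p + of_real t * q)) (at s)"
    and pq: "\<And>s t. s \<in> {0..h} \<Longrightarrow> t \<in> {0..h} \<Longrightarrow>
        ((\<lambda>t. up (z + of_real s * p + of_real t * q)) has_real_derivative upq (z + of_real s * p + of_real t * q)) (at t)"
  obtains s t where "s \<in> {0..h}" "t \<in> {0..h}"
    "u (z + of_real h * p + of_real h * q) - u (z + of_real h * p) - u (z + of_real h * q) + u z
       = h\<^sup>2 * upq (z + of_real s * p + of_real t * q)"
proof -
  let ?\<phi> = "\<lambda>s. u (z + of_real s * p + of_real h * q) - u (z + of_real s * p)"
  have "\<exists>s>0. s < h \<and> ?\<phi> h - ?\<phi> 0 = (h - 0) * (up (z + of_real s * p + of_real h * q) - up (z + of_real s * p))"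
  proof (rule MVT2[OF \<open>h > 0\<close>])
    fix s assume "0 \<le> s" "s \<le> h"
    then show "(?\<phi> has_real_derivative up (z + of_real s * p + of_real h * q) - up (z + of_real s * p)) (at s)"
      using DERIV_diff[OF p[of s h] p[of s 0]] \<open>h > 0\<close> by simp
  qed
  then obtain s where s: "0 < s" "s < h"
    "?\<phi> h - ?\<phi> 0 = h * (up (z + of_real s * p + of_real h * q) - up (z + of_real s * p))"
    by auto
  have "\<exists>t>0. t < h \<and> up (z + of_real s * p + of_real h * q) - up (z + of_real s * p + of_real 0 * q)
      = (h - 0) * upq (z + of_real s * p + of_real t * q)"
    using s by (intro MVT2[OF \<open>h > 0\<close>] pq) auto
  then obtain t where "0 < t" "t < h"
    "up (z + of_real s * p + of_real h * q) - up (z + of_real s * p) = h * upq (z + of_real s * p + of_real t * q)"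
    by auto
  with s that[of s t] show thesis
    by (simp add: power2_eq_square algebra_simps)
qed

lemma has_real_derivative_along:
  fixes u :: "complex \<Rightarrow> real"
  assumes "u differentiable at (a + of_real s * p)"
  shows "((\<lambda>s. u (a + of_real s * p)) has_real_derivative
     Re p * dx u (a + of_real s * p) + Im p * dy u (a + of_real s * p)) (at s)"
proof -
  have "((\<lambda>s. a + of_real s * p) has_derivative (\<lambda>h. of_real h * p)) (at s)"
    by (auto intro!: derivative_eq_intros)
  from has_derivative_compose[OF this has_derivative_dx_dy[OF assms]]
  show ?thesis
    unfolding has_field_derivative_def
    by (rule has_derivative_eq_rhs) (auto simp: algebra_simps)
qed

text \<open>The second difference over a small square does not depend on the order of the
  directions, so it equals a value of either mixed derivative near \<open>z\<close>; continuity
  forces agreement at \<open>z\<close>.\<close>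

lemma mixed_partials_eq:
  fixes u :: "complex \<Rightarrow> real"
  assumes "open S" and "z \<in> S" and u: "C2_map_on S u"
  shows "dy (dx u) z = dx (dy u) z"
proof (rule ccontr)
  have d: "\<And>w. w \<in> S \<Longrightarrow> u differentiable at w" "\<And>w. w \<in> S \<Longrightarrow> dx u differentiable at w"
      "\<And>w. w \<in> S \<Longrightarrow> dy u differentiable at w"
    and c: "continuous_on S (dy (dx u))" "continuous_on S (dx (dy u))"
    using u by (auto simp: C2_map_on_def C1_map_on_def)
  \<comment> \<open>With half the gap as tolerance, the two mixed derivatives cannot share a value
    near \<open>z\<close>.\<close>
  define e where "e = \<bar>dy (dx u) z - dx (dy u) z\<bar> / 2"
  assume "dy (dx u) z \<noteq> dx (dy u) z"
  then have "e > 0" by (simp add: e_def)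
  obtain d0 where d0: "d0 > 0" "ball z d0 \<subseteq> S"
    using \<open>open S\<close> \<open>z \<in> S\<close> openE by blast
  obtain d1 where d1: "d1 > 0" "\<And>w. w \<in> S \<Longrightarrow> dist w z < d1 \<Longrightarrow> dist (dy (dx u) w) (dy (dx u) z) < e"
    using c(1) \<open>z \<in> S\<close> \<open>e > 0\<close> unfolding continuous_on_iff by meson
  obtain d2 where d2: "d2 > 0" "\<And>w. w \<in> S \<Longrightarrow> dist w z < d2 \<Longrightarrow> dist (dx (dy u) w) (dx (dy u) z) < e"
    using c(2) \<open>z \<in> S\<close> \<open>e > 0\<close> unfolding continuous_on_iff by meson
  \<comment> \<open>Points of the square of side \<open>h\<close> lie within 2h of \<open>z\<close>,
    and dividing by 3 keeps 2h below all three radii.\<close>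
  define h where "h = Min {d0, d1, d2} / 3"
  have h: "h > 0" "2 * h < d0" "2 * h < d1" "2 * h < d2"
    using d0(1) d1(1) d2(1) by (auto simp: h_def min_def)
  have near: "dist (z + of_real s + of_real t * \<i>) z \<le> 2 * h" if "s \<in> {0..h}" "t \<in> {0..h}" for s t
  proof -
    have "dist (z + of_real s + of_real t * \<i>) z = norm (of_real s + of_real t * \<i>)"
      by (simp add: dist_norm add.assoc)
    also have "\<dots> \<le> \<bar>s\<bar> + \<bar>t\<bar>"
      by (rule norm_triangle_mono) (auto simp: norm_mult)
    finally show ?thesis using that by simp
  qed
  then have inS: "z + of_real s + of_real t * \<i> \<in> S" if "s \<in> {0..h}" "t \<in> {0..h}" for s t
    using near[OF that] h d0(2) by (force simp: dist_commute)
  obtain s t where st: "s \<in> {0..h}" "t \<in> {0..h}"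
    "u (z + of_real h * 1 + of_real h * \<i>) - u (z + of_real h * 1) - u (z + of_real h * \<i>) + u z
       = h\<^sup>2 * dy (dx u) (z + of_real s * 1 + of_real t * \<i>)"
  proof (rule second_difference_mean_value[OF \<open>h > 0\<close>])
    fix s t assume "s \<in> {0..h}" "t \<in> {0..h}"
    note S = inS[OF this]
    show "((\<lambda>s. u (z + of_real s * 1 + of_real t * \<i>)) has_real_derivative
        dx u (z + of_real s * 1 + of_real t * \<i>)) (at s)"
      using has_real_derivative_along[of u "z + of_real t * \<i>" s 1] d(1)[OF S]
      by (simp add: algebra_simps)
    show "((\<lambda>t. dx u (z + of_real s * 1 + of_real t * \<i>)) has_real_derivative
        dy (dx u) (z + of_real s * 1 + of_real t * \<i>)) (at t)"
      using has_real_derivative_along[of "dx u" "z + of_real s" t \<i>] d(2)[OF S]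
      by (simp add: algebra_simps)
  qed
  obtain s' t' where st': "s' \<in> {0..h}" "t' \<in> {0..h}"
    "u (z + of_real h * \<i> + of_real h * 1) - u (z + of_real h * \<i>) - u (z + of_real h * 1) + u z
       = h\<^sup>2 * dx (dy u) (z + of_real t' * \<i> + of_real s' * 1)"
  proof (rule second_difference_mean_value[OF \<open>h > 0\<close>])
    fix t s assume "t \<in> {0..h}" "s \<in> {0..h}"
    note S = inS[OF this(2,1)]
    show "((\<lambda>t. u (z + of_real t * \<i> + of_real s * 1)) has_real_derivative
        dy u (z + of_real t * \<i> + of_real s * 1)) (at t)"
      using has_real_derivative_along[of u "z + of_real s" t \<i>] d(1)[OF S]
      by (simp add: algebra_simps)
    show "((\<lambda>s. dy u (z + of_real t * \<i> + of_real s * 1)) has_real_derivative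
        dx (dy u) (z + of_real t * \<i> + of_real s * 1)) (at s)"
      using has_real_derivative_along[of "dy u" "z + of_real t * \<i>" s 1] d(3)[OF S]
      by (simp add: algebra_simps)
  qed
  have "h\<^sup>2 * dy (dx u) (z + of_real s + of_real t * \<i>) = h\<^sup>2 * dx (dy u) (z + of_real s' + of_real t' * \<i>)"
    using st(3) st'(3) by (simp add: algebra_simps)
  then have "dy (dx u) (z + of_real s + of_real t * \<i>) = dx (dy u) (z + of_real s' + of_real t' * \<i>)"
    using \<open>h > 0\<close> by simp
  moreover have "dist (dy (dx u) (z + of_real s + of_real t * \<i>)) (dy (dx u) z) < e"
    using d1(2)[OF inS[OF st(1,2)]] near[OF st(1,2)] h(3) by linarith
  moreover have "dist (dx (dy u) (z + of_real s' + of_real t' * \<i>)) (dx (dy u) z) < e"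
    using d2(2)[OF inS[OF st'(1,2)]] near[OF st'(1,2)] h(4) by linarith
  ultimately show False
    by (simp add: e_def dist_real_def abs_if split: if_splits)
qed

text \<open>With \<open>u\<close> the real part of \<open>F\<close> up to a constant, this is Cauchy's inequality for \<open>exp \<circ> F\<close>.\<close>

lemma harmonic_gradient_bound:
  fixes u :: "complex \<Rightarrow> real"
  assumes u: "harmonic_map_on (ball 0 r) u" and "r > 0"
    and bd: "\<And>z. z \<in> ball 0 r \<Longrightarrow> \<bar>u z - u 0\<bar> \<le> 1"
  shows "\<bar>dx u 0\<bar> \<le> 2 * exp 1 / r"
proof -
  let ?B = "ball (0::complex) r"
  have C2: "C2_map_on ?B u" and L: "\<And>z. z \<in> ?B \<Longrightarrow> dx (dx u) z + dy (dy u) z = 0"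
    using u by (auto simp: harmonic_map_on_def)
  have d: "\<And>w. w \<in> ?B \<Longrightarrow> u differentiable at w" "\<And>w. w \<in> ?B \<Longrightarrow> dx u differentiable at w"
      "\<And>w. w \<in> ?B \<Longrightarrow> dy u differentiable at w"
    using C2 by (auto simp: C2_map_on_def C1_map_on_def)
  \<comment> \<open>This is the derivative of a holomorphic function with real part
    \<open>u\<close>. Its Cauchy-Riemann equations are Laplace's equation and the symmetry of the
    mixed partials.\<close>
  define h where "h z = Complex (dx u z) (- dy u z)" for z
  have h': "(h has_field_derivative Complex (dx (dx u) z) (- dx (dy u) z)) (at z)" if "z \<in> ?B" for z
  proof -
    have e: "h = (\<lambda>z. of_real (dx u z) - \<i> * of_real (dy u z))"
      by (auto simp: h_def complex_eq_iff)
    have "(h has_derivative (\<lambda>w. of_real (Re w *\<^sub>R dx (dx u) z + Im w *\<^sub>R dy (dx u) z)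
        - \<i> * of_real (Re w *\<^sub>R dx (dy u) z + Im w *\<^sub>R dy (dy u) z))) (at z)"
      unfolding e
      by (intro has_derivative_diff has_derivative_mult_right has_derivative_of_real
          has_derivative_dx_dy d that)
    moreover have "dy (dx u) z = dx (dy u) z" "dy (dy u) z = - dx (dx u) z"
      using mixed_partials_eq[OF _ that C2] L[OF that] by auto
    ultimately show ?thesis
      unfolding has_field_derivative_def
      by (rule_tac has_derivative_eq_rhs) (auto simp: fun_eq_iff complex_eq_iff algebra_simps)
  qed
  then have "h holomorphic_on ?B"
    by (meson DERIV_subset field_differentiable_def holomorphic_onI field_differentiable_at_within)
  then obtain F where "\<And>x. x \<in> ?B \<Longrightarrow> (F has_field_derivative h x) (at x within ?B)"
    using holomorphic_convex_primitive'[of ?B h] by auto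
  then have F: "(F has_field_derivative h x) (at x)" if "x \<in> ?B" for x
    using that by (metis at_within_open open_ball)
  \<comment> \<open>The real part of \<open>h z * w\<close> is the differential of \<open>u\<close>
    at \<open>z\<close>, so on the convex ball the difference is a constant
    \<open>k\<close>.\<close>
  have "((\<lambda>z. Re (F z) - u z) has_derivative (\<lambda>w. 0)) (at z within ?B)" if "z \<in> ?B" for z
  proof -
    have "((\<lambda>z. Re (F z) - u z) has_derivative
       (\<lambda>w. Re (h z * w) - (Re w *\<^sub>R dx u z + Im w *\<^sub>R dy u z))) (at z)"
      by (intro has_derivative_diff bounded_linear.has_derivative[OF bounded_linear_Re]
          has_derivative_dx_dy d that F[OF that, unfolded has_field_derivative_def])
    then show ?thesis
      by (auto simp: h_def algebra_simps intro: has_derivative_at_withinI)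
  qed
  from has_derivative_zero_constant[OF convex_ball this] obtain k where
    k: "\<And>z. z \<in> ?B \<Longrightarrow> Re (F z) - u z = k" by blast
  let ?G = "\<lambda>z. exp (F z)"
  have G': "(?G has_field_derivative exp (F z) * h z) (at z)" if "z \<in> ?B" for z
    using F[OF that] by (auto intro!: derivative_eq_intros)
  have holG: "?G holomorphic_on ?B"
    using G' by (meson holomorphic_onI field_differentiable_def field_differentiable_at_within)
  \<comment> \<open>The modulus of \<open>exp (F z)\<close> is exp (u z + k), at most exp (u 0 + k +
    1) by \<open>bd\<close>. The radius r/2 gives continuity on the closed disc and accounts for the
    factor 2; exp (u 0 + k) cancels later against the modulus of \<open>exp (F 0)\<close>.\<close>
  have "norm ((deriv ^^ 1) ?G 0) \<le> fact 1 * exp (u 0 + k + 1) / (r / 2) ^ 1"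
  proof (rule Cauchy_inequality)
    show "?G holomorphic_on ball 0 (r/2)" "continuous_on (cball 0 (r/2)) ?G"
      using \<open>r > 0\<close> holG by (auto intro!: holomorphic_on_imp_continuous_on elim!: holomorphic_on_subset)
    show "0 < r / 2" using \<open>r > 0\<close> by simp
    fix x :: complex assume "norm (0 - x) = r / 2"
    then have "x \<in> ?B" using \<open>r > 0\<close> by simp
    from k[OF this] bd[OF this] show "norm (?G x) \<le> exp (u 0 + k + 1)"
      by (auto simp: abs_le_iff)
  qed
  moreover have "deriv ?G 0 = exp (F 0) * h 0"
    using G' \<open>r > 0\<close> by (intro DERIV_imp_deriv) auto
  moreover have "norm (exp (F 0)) = exp (u 0 + k)"
    using k[of 0] \<open>r > 0\<close> by (simp add: algebra_simps)
  ultimately have "exp (u 0 + k) * norm (h 0) \<le> exp (u 0 + k) * (2 * exp 1 / r)"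
    by (simp add: norm_mult exp_add mult_ac)
  then have "norm (h 0) \<le> 2 * exp 1 / r"
    by (rule mult_left_le_imp_le) simp
  moreover have "\<bar>dx u 0\<bar> \<le> norm (h 0)"
    using abs_Re_le_cmod[of "h 0"] by (simp add: h_def)
  ultimately show ?thesis by linarith
qed

section \<open>The minimal pseudometric\<close>

lemma minimal_metric_le:
  assumes "f \<in> CH unit_disc \<Omega>" and "f 0 = x" and "dx f 0 = r *\<^sub>R v" and "r > 0"
  shows "minimal_metric \<Omega> x v \<le> 1 / r"
  unfolding minimal_metric_def
proof (rule cInf_lower)
  show "bdd_below {1 / r |r. 0 < r \<and> (\<exists>f\<in>CH unit_disc \<Omega>. f 0 = x \<and> dx f 0 = r *\<^sub>R v)}"
    by (rule bdd_belowI[of _ 0]) auto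
qed (use assms in blast)

text \<open>In dimension at least 2 some vector \<open>w\<close> is orthogonal to \<open>v\<close>
  and of the same length; the two span a round disc of radius \<open>norm v\<close> about
  \<open>x\<close>, constant if \<open>v = 0\<close>. The values at real parameters serve to hit a
  prescribed second point.\<close>

lemma flat_disc:
  fixes x v :: "'a::euclidean_space"
  assumes "DIM('a) \<ge> 2" and sub: "ball x s \<subseteq> \<Omega>" and v: "norm v \<le> s" and "s > 0"
  obtains f where "f \<in> CH unit_disc \<Omega>" "\<And>t. f (of_real t) = x + t *\<^sub>R v" "dx f 0 = v"
proof -
  obtain y where y: "y \<noteq> 0" "orthogonal v y"
    using orthogonal_to_vector_exists[OF assms(1)] by blast
  define w where "w = (norm v / norm y) *\<^sub>R y"
  have nw: "norm v = norm w" and o: "v \<bullet> w = 0"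
    using y by (auto simp: w_def orthogonal_def)
  have "x + Re z *\<^sub>R v + Im z *\<^sub>R w \<in> \<Omega>" if "z \<in> unit_disc" for z
  proof -
    have "(norm (Re z *\<^sub>R v + Im z *\<^sub>R w))\<^sup>2 = (norm (Re z *\<^sub>R v))\<^sup>2 + (norm (Im z *\<^sub>R w))\<^sup>2"
      by (rule norm_add_Pythagorean) (simp add: orthogonal_def o)
    also have "\<dots> = (norm z * norm v)\<^sup>2"
      by (simp add: nw power_mult_distrib cmod_power2 algebra_simps)
    finally have "norm (Re z *\<^sub>R v + Im z *\<^sub>R w) = norm z * norm v"
      by simp
    also have "\<dots> < s"
    proof (cases "v = 0")
      case False
      then have "norm z * norm v < 1 * norm v"
        using that by (intro mult_strict_right_mono) auto
      then show ?thesis using v by simp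
    qed (use \<open>s > 0\<close> in simp)
    finally have "x + (Re z *\<^sub>R v + Im z *\<^sub>R w) \<in> ball x s"
      by (simp only: mem_ball dist_norm norm_minus_commute[of x] add_diff_cancel_left')
    then show ?thesis using sub by (auto simp: add.assoc)
  qed
  then have "(\<lambda>z. x + Re z *\<^sub>R v + Im z *\<^sub>R w) ` unit_disc \<subseteq> \<Omega>"
    by blast
  note f = flat_map_in_CH[OF nw o this]
  show thesis
    by (rule that[OF f(1)]) (simp_all add: f(2))
qed

lemma minimal_metric_le_flat:
  fixes x v :: "'a::euclidean_space"
  assumes "DIM('a) \<ge> 2" and "ball x s \<subseteq> \<Omega>" and "s > 0"
  shows "minimal_metric \<Omega> x v \<le> norm v / s"
proof (rule dense_ge)
  \<comment> \<open>Testing every \<open>K\<close> above the bound instead of the bound itself keeps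
    1/K meaningful when \<open>v = 0\<close>.\<close>
  fix K assume K: "norm v / s < K"
  moreover have "0 \<le> norm v / s"
    using \<open>s > 0\<close> by simp
  ultimately have "K > 0" by linarith
  have "norm ((1 / K) *\<^sub>R v) \<le> s"
    using K \<open>K > 0\<close> \<open>s > 0\<close> by (simp add: field_simps)
  then obtain f where f: "f \<in> CH unit_disc \<Omega>" "\<And>t. f (of_real t) = x + t *\<^sub>R ((1 / K) *\<^sub>R v)"
      "dx f 0 = (1 / K) *\<^sub>R v"
    using flat_disc[OF assms(1,2) _ \<open>s > 0\<close>] by blast
  have "f 0 = x"
    using f(2)[of 0] by simp
  from minimal_metric_le[OF f(1) this f(3)] \<open>K > 0\<close>
  show "minimal_metric \<Omega> x v \<le> K" by simp
qed

text \<open>Nonemptiness is what allows lower estimates of the real \<open>Inf\<close> to be checked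
  disc by disc.\<close>

lemma minimal_metric_nonempty:
  fixes x v :: "'a::euclidean_space"
  assumes "DIM('a) \<ge> 2" and "open \<Omega>" and "x \<in> \<Omega>"
  shows "{1 / r |r. 0 < r \<and> (\<exists>f\<in>CH unit_disc \<Omega>. f 0 = x \<and> dx f 0 = r *\<^sub>R v)} \<noteq> {}"
proof -
  obtain s where s: "s > 0" "ball x s \<subseteq> \<Omega>"
    using assms openE by blast
  \<comment> \<open>Adding 1 keeps \<open>r\<close> positive also for \<open>v = 0\<close>.\<close>
  define r where "r = s / (norm v + 1)"
  have "r > 0"
    using s(1) by (simp add: r_def add_nonneg_pos)
  have "r * norm v \<le> r * (norm v + 1)"
    using \<open>r > 0\<close> by simp
  also have "\<dots> = s"
    using add_nonneg_pos[OF norm_ge_zero[of v] zero_less_one] by (simp add: r_def)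
  finally have "norm (r *\<^sub>R v) \<le> s"
    using \<open>r > 0\<close> by simp
  then obtain f where f: "f \<in> CH unit_disc \<Omega>" "\<And>t. f (of_real t) = x + t *\<^sub>R (r *\<^sub>R v)" "dx f 0 = r *\<^sub>R v"
    using flat_disc[OF assms(1) s(2) _ s(1)] by blast
  moreover have "f 0 = x"
    using f(2)[of 0] by simp
  ultimately show ?thesis using \<open>r > 0\<close> by blast
qed

text \<open>A competitor with factor \<open>r\<close> for \<open>v\<close> is one with factor
  \<open>r / t\<close> for \<open>t *\<^sub>R v\<close>. This handles the doubled speed of joined
  paths.\<close>

lemma minimal_metric_scaleR_le:
  fixes x v :: "'a::euclidean_space"
  assumes "DIM('a) \<ge> 2" and "open \<Omega>" and "x \<in> \<Omega>" and "t > 0"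
  shows "minimal_metric \<Omega> x (t *\<^sub>R v) \<le> t * minimal_metric \<Omega> x v"
proof -
  have "minimal_metric \<Omega> x (t *\<^sub>R v) / t \<le> minimal_metric \<Omega> x v"
    unfolding minimal_metric_def[of \<Omega> x v]
  proof (rule cInf_greatest[OF minimal_metric_nonempty[OF assms(1-3)]])
    fix K assume "K \<in> {1 / r |r. 0 < r \<and> (\<exists>f\<in>CH unit_disc \<Omega>. f 0 = x \<and> dx f 0 = r *\<^sub>R v)}"
    then obtain r f where r: "K = 1 / r" "r > 0" and f: "f \<in> CH unit_disc \<Omega>" "f 0 = x" "dx f 0 = r *\<^sub>R v"
      by blast
    have "dx f 0 = (r / t) *\<^sub>R (t *\<^sub>R v)"
      using f(3) \<open>t > 0\<close> by simp
    from minimal_metric_le[OF f(1,2) this] r(2) \<open>t > 0\<close>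
    show "minimal_metric \<Omega> x (t *\<^sub>R v) / t \<le> K"
      unfolding r(1) by (simp add: field_simps)
  qed
  then show ?thesis using \<open>t > 0\<close> by (simp add: field_simps)
qed

text \<open>A disc of radius at most 1/2 about a point of modulus below 1/2 stays in the unit disc;
  this is the source of the constant 2 in \<open>minimal_metric_disc_le\<close>.\<close>

lemma CH_half_disc:
  assumes "f \<in> CH unit_disc \<Omega>" and "norm a < 1 / 2" and "norm b \<le> 1 / 2"
  shows "(\<lambda>w. f (a + b * w)) \<in> CH unit_disc \<Omega>"
proof (rule CH_affine[OF assms(1)])
  have "norm (a + b * w) < 1" if "norm w < 1" for w
  proof -
    have "norm b * norm w \<le> 1 / 2 * 1"
      using assms(3) that by (intro mult_mono) auto
    then show ?thesis
      using norm_triangle_ineq[of a "b * w"] assms(2) by (simp add: norm_mult)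
  qed
  then show "(\<lambda>w. a + b * w) ` unit_disc \<subseteq> unit_disc" by auto
qed simp

lemma CH_C1: "f \<in> CH S \<Omega> \<Longrightarrow> C1_map_on S f"
  by (simp add: CH_def conformal_map_on_def)

text \<open>Recentring at \<open>z\<close> and multiplying the parameter by \<open>b\<close> turns
  the differential of \<open>f\<close> at \<open>z\<close> along \<open>w\<close>, up to scale, into
  the x-derivative of a new disc, hence into a competitor. It is a Schwarz-Pick bound with a uniform
  constant on the half disc.\<close>

lemma minimal_metric_disc_le:
  fixes f :: "complex \<Rightarrow> 'a::euclidean_space"
  assumes f: "f \<in> CH unit_disc \<Omega>" and z: "norm z < 1 / 2"
  shows "minimal_metric \<Omega> (f z) (Re w *\<^sub>R dx f z + Im w *\<^sub>R dy f z) \<le> 2 * norm w"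
proof (rule dense_ge)
  fix K assume K: "2 * norm w < K"
  then have "K > 0"
    using norm_ge_zero[of w] by linarith
  define b where "b = w / of_real K"
  have "norm b \<le> 1 / 2"
    using K \<open>K > 0\<close> by (simp add: b_def norm_divide field_simps)
  note g = CH_half_disc[OF f z this]
  have "(\<lambda>w. z + b * w) ` {0} \<subseteq> unit_disc"
    using z by simp
  from C1_map_on_affine(2)[OF CH_C1[OF f] this]
  have "dx (\<lambda>w. f (z + b * w)) 0 = Re b *\<^sub>R dx f z + Im b *\<^sub>R dy f z"
    by simp
  also have "\<dots> = (1 / K) *\<^sub>R (Re w *\<^sub>R dx f z + Im w *\<^sub>R dy f z)"
    by (simp add: b_def scaleR_add_right)
  finally show "minimal_metric \<Omega> (f z) (Re w *\<^sub>R dx f z + Im w *\<^sub>R dy f z) \<le> K"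
    using minimal_metric_le[OF g] \<open>K > 0\<close> by fastforce
qed

lemma CH_has_vector_derivative:
  fixes f :: "complex \<Rightarrow> 'a::real_inner"
  assumes "f \<in> CH S \<Omega>" and "a + of_real t * w \<in> S"
  shows "((\<lambda>t. f (a + of_real t * w)) has_vector_derivative
     Re w *\<^sub>R dx f (a + of_real t * w) + Im w *\<^sub>R dy f (a + of_real t * w)) (at t)"
proof -
  have "f differentiable at (a + of_real t * w)"
    using CH_C1[OF assms(1)] assms(2) by (simp add: C1_map_on_def)
  note f = has_derivative_dx_dy[OF this]
  have "((\<lambda>t. a + of_real t * w) has_derivative (\<lambda>h. of_real h * w)) (at t)"
    by (auto intro!: derivative_eq_intros)
  from has_derivative_compose[OF this f]
  show ?thesis
    unfolding has_vector_derivative_def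
    by (rule has_derivative_eq_rhs) (auto simp: algebra_simps)
qed

text \<open>The first time at distance at least \<open>s\<close> is the minimum of a compact set.
  Lower bounds on g are known only inside a ball, so discs and paths are cut at this time.\<close>

lemma exit_time:
  fixes \<gamma> :: "real \<Rightarrow> 'a::metric_space"
  assumes "continuous_on {0..b} \<gamma>" and "0 \<le> b" and "dist x (\<gamma> 0) < s" and "s \<le> dist x (\<gamma> b)"
  obtains t where "0 < t" "t \<le> b" "dist x (\<gamma> t) = s" "\<And>u. 0 \<le> u \<Longrightarrow> u < t \<Longrightarrow> dist x (\<gamma> u) < s"
proof -
  let ?d = "\<lambda>u. dist x (\<gamma> u)"
  have c: "continuous_on {0..b} ?d"
    by (intro continuous_intros assms(1))
  define T where "T = {u \<in> {0..b}. s \<le> ?d u}"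
  have "compact T"
    unfolding compact_eq_bounded_closed T_def
    using continuous_on_closed_Collect_le[OF continuous_on_const c closed_atLeastAtMost]
    by (auto intro: bounded_subset[OF bounded_closed_interval])
  moreover have "T \<noteq> {}"
    using assms by (auto simp: T_def)
  ultimately obtain t where t: "t \<in> T" "\<And>u. u \<in> T \<Longrightarrow> t \<le> u"
    using compact_attains_inf[of T] by blast
  have below: "?d u < s" if "0 \<le> u" "u < t" for u
    using t that by (force simp: T_def)
  have "\<exists>u. 0 \<le> u \<and> u \<le> t \<and> ?d u = s"
  proof (rule IVT')
    show "continuous_on {0..t} ?d"
      by (rule continuous_on_subset[OF c]) (use t(1) in \<open>auto simp: T_def\<close>)
  qed (use t(1) assms in \<open>auto simp: T_def\<close>)
  then have "?d t = s"
    using below by (metis less_eq_real_def less_irrefl)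
  moreover have "0 < t"
    using t(1) assms(3) by (cases "t = 0") (auto simp: T_def)
  ultimately show thesis
    using that[of t] t(1) below by (auto simp: T_def)
qed

section \<open>A metric making all discs equicontinuous\<close>

text \<open>Along the segment, \<open>c\<close> times the speed is at most g by \<open>hyp\<close>,
  and g is at most \<open>2 * norm (b - a)\<close>; the mean value inequality does the rest.
  \<open>inside\<close> stops short of \<open>T\<close>, so that \<open>T\<close> may be an exit
  time.\<close>

lemma disc_displacement:
  fixes f :: "complex \<Rightarrow> 'a::euclidean_space"
  assumes f: "f \<in> CH unit_disc \<Omega>" and a: "norm a < 1 / 2" and b: "norm b < 1 / 2" and "c > 0"
    and hyp: "\<And>y u. y \<in> ball x s \<Longrightarrow> c * norm u \<le> minimal_metric \<Omega> y u"
    and T: "0 < T" "T \<le> 1" and inside: "\<And>t. 0 \<le> t \<Longrightarrow> t < T \<Longrightarrow> f (a + of_real t * (b - a)) \<in> ball x s"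
  shows "dist (f a) (f (a + of_real T * (b - a))) \<le> 2 / c * norm (b - a)"
proof -
  let ?p = "\<lambda>t. a + of_real t * (b - a)"
  let ?D = "\<lambda>t. Re (b - a) *\<^sub>R dx f (?p t) + Im (b - a) *\<^sub>R dy f (?p t)"
  have p: "norm (?p t) < 1 / 2" if "0 \<le> t" "t \<le> 1" for t
  proof -
    have "?p t = (1 - t) *\<^sub>R a + t *\<^sub>R b"
      by (simp add: scaleR_conv_of_real algebra_simps)
    moreover have "(1 - t) *\<^sub>R a + t *\<^sub>R b \<in> ball 0 (1/2)"
      using a b that by (intro convexD[OF convex_ball]) auto
    ultimately show ?thesis by simp
  qed
  have der: "((\<lambda>t. f (?p t)) has_vector_derivative ?D t) (at t)" if "0 \<le> t" "t \<le> 1" for t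
    using p[OF that] by (intro CH_has_vector_derivative[OF f]) auto
  have "norm (f (?p T) - f (?p 0)) \<le> 2 / c * norm (b - a) * T - 2 / c * norm (b - a) * 0"
  proof (rule differentiable_bound_general[OF T(1)])
    show "continuous_on {0..T} (\<lambda>t. f (?p t))"
      using der T by (intro continuous_at_imp_continuous_on) (force intro: has_vector_derivative_continuous)
    fix t assume t: "0 < t" "t < T"
    then show "((\<lambda>t. f (?p t)) has_vector_derivative ?D t) (at t)"
      using der T by simp
    show "((\<lambda>t. 2 / c * norm (b - a) * t) has_vector_derivative 2 / c * norm (b - a)) (at t)"
      unfolding has_vector_derivative_def
      by (rule has_derivative_eq_rhs, rule has_derivative_mult_right, rule has_derivative_ident) (simp add: mult_ac)
    have "c * norm (?D t) \<le> minimal_metric \<Omega> (f (?p t)) (?D t)"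
      using hyp inside t by simp
    also have "\<dots> \<le> 2 * norm (b - a)"
      using t T by (intro minimal_metric_disc_le[OF f p]) auto
    finally show "norm (?D t) \<le> 2 / c * norm (b - a)"
      using \<open>c > 0\<close> by (simp add: pos_le_divide_eq mult.commute)
  qed (intro continuous_intros)
  also have "\<dots> \<le> 2 / c * norm (b - a) * 1"
    unfolding mult_zero_right diff_zero
    using T \<open>c > 0\<close> by (intro mult_left_mono) auto
  finally show ?thesis by (simp add: dist_norm norm_minus_commute)
qed

text \<open>Testing the centre 0 and \<open>norm z < 1 / 2\<close> suffices because discs can be
  recentred and rescaled; values in [0, 1] keep the supremum below finite.\<close>

definition disc_contractions :: "'a::euclidean_space set \<Rightarrow> ('a \<Rightarrow> real) set" where
  "disc_contractions \<Omega> = {u. range u \<subseteq> {0..1} \<and>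
     (\<forall>f\<in>CH unit_disc \<Omega>. \<forall>z. norm z < 1 / 2 \<longrightarrow> \<bar>u (f z) - u (f 0)\<bar> \<le> norm z)}"

text \<open>A Caratheodory-type pseudodistance: symmetry and the triangle inequality are inherited
  from the real line.\<close>

definition contraction_dist :: "'a::euclidean_space set \<Rightarrow> 'a \<Rightarrow> 'a \<Rightarrow> real" where
  "contraction_dist \<Omega> x y = (SUP u\<in>disc_contractions \<Omega>. \<bar>u x - u y\<bar>)"

lemma const_in_disc_contractions: "(\<lambda>x. 0) \<in> disc_contractions \<Omega>"
  by (simp add: disc_contractions_def)

lemma contraction_dist_ge:
  assumes "u \<in> disc_contractions \<Omega>"
  shows "\<bar>u x - u y\<bar> \<le> contraction_dist \<Omega> x y"
proof -
  have "bdd_above ((\<lambda>u. \<bar>u x - u y\<bar>) ` disc_contractions \<Omega>)"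
  proof (rule bdd_aboveI2[where M=1])
    fix u assume "u \<in> disc_contractions \<Omega>"
    then have "u x \<in> {0..1}" "u y \<in> {0..1}"
      unfolding disc_contractions_def by blast+
    then show "\<bar>u x - u y\<bar> \<le> 1" by auto
  qed
  then show ?thesis
    using assms unfolding contraction_dist_def by (intro cSUP_upper)
qed

lemma contraction_dist_le:
  assumes "\<And>u. u \<in> disc_contractions \<Omega> \<Longrightarrow> \<bar>u x - u y\<bar> \<le> C"
  shows "contraction_dist \<Omega> x y \<le> C"
  using assms const_in_disc_contractions unfolding contraction_dist_def
  by (intro cSUP_least) auto

text \<open>The disc of radius 1 - |z| about \<open>z\<close> is rescaled to the unit disc. The
  point \<open>w\<close> then has parameter \<open>(w - z) / b\<close>, and the hypothesis on
  \<open>dist z w\<close> makes its modulus less than 1/2.\<close>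

lemma contraction_dist_disc_le:
  assumes f: "f \<in> CH unit_disc \<Omega>" and z: "norm z < 1" and w: "dist z w < (1 - norm z) / 2"
  shows "contraction_dist \<Omega> (f z) (f w) \<le> dist z w / (1 - norm z)"
proof (rule contraction_dist_le)
  fix u assume u: "u \<in> disc_contractions \<Omega>"
  define b where "b = complex_of_real (1 - norm z)"
  have b: "b \<noteq> 0" "norm b = 1 - norm z"
    using z by (auto simp: b_def simp del: of_real_diff)
  have "norm (z + b * w) < 1" if "norm w < 1" for w
  proof -
    have "norm b * norm w < norm b * 1"
      using that b z by (intro mult_strict_left_mono) auto
    then show ?thesis
      using norm_triangle_ineq[of z "b * w"] b(2) by (simp add: norm_mult)
  qed
  then have g: "(\<lambda>w. f (z + b * w)) \<in> CH unit_disc \<Omega>"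
    by (intro CH_affine[OF f]) auto
  have n: "norm ((w - z) / b) = dist z w / (1 - norm z)"
    using b by (simp add: norm_divide dist_norm norm_minus_commute)
  then have "norm ((w - z) / b) < 1 / 2"
    unfolding n using w z by (simp add: pos_divide_less_eq)
  moreover have "\<forall>g\<in>CH unit_disc \<Omega>. \<forall>w. norm w < 1 / 2 \<longrightarrow> \<bar>u (g w) - u (g 0)\<bar> \<le> norm w"
    using u by (simp add: disc_contractions_def)
  note bspec[OF this g, rule_format, of "(w - z) / b"]
  ultimately have "\<bar>u (f (z + b * ((w - z) / b))) - u (f (z + b * 0))\<bar> \<le> norm ((w - z) / b)"
    by blast
  then show "\<bar>u (f z) - u (f w)\<bar> \<le> dist z w / (1 - norm z)"
    using b(1) n by (simp add: abs_minus_commute)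
qed

text \<open>A flat disc of radius \<open>s\<close> centred at \<open>x\<close> passes through
  \<open>y\<close> at the parameter \<open>dist x y / s\<close>.\<close>

lemma contraction_dist_le_flat:
  fixes x y :: "'a::euclidean_space"
  assumes "DIM('a) \<ge> 2" and "ball x s \<subseteq> \<Omega>" and "s > 0" and "dist x y < s / 2"
  shows "contraction_dist \<Omega> x y \<le> dist x y / s"
proof (cases "x = y")
  case True
  then show ?thesis
    by (auto intro: contraction_dist_le)
next
  case False
  define v where "v = (s / dist x y) *\<^sub>R (y - x)"
  have "norm v \<le> s"
    using False \<open>s > 0\<close> by (simp add: v_def dist_norm norm_minus_commute)
  then obtain f where f: "f \<in> CH unit_disc \<Omega>" "\<And>t. f (of_real t) = x + t *\<^sub>R v"
    using flat_disc[OF assms(1,2) _ \<open>s > 0\<close>] by metis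
  have "f 0 = x"
    using f(2)[of 0] by simp
  moreover have "f (of_real (dist x y / s)) = y"
    using f(2)[of "dist x y / s"] False \<open>s > 0\<close> by (simp add: v_def)
  moreover have "contraction_dist \<Omega> (f 0) (f (of_real (dist x y / s))) \<le>
      dist 0 (complex_of_real (dist x y / s)) / (1 - norm (0::complex))"
    using assms(3,4) by (intro contraction_dist_disc_le[OF f(1)]) (auto simp: field_simps norm_divide)
  ultimately show ?thesis
    using \<open>s > 0\<close> by (simp add: norm_divide)
qed

text \<open>The lower bound on g holds only in the ball, so the distance is cut off at
  \<open>s\<close> and constant outside. \<open>k \<le> c / 2\<close> absorbs the constant 2/c of
  \<open>disc_displacement\<close>, and \<open>k * s \<le> 1\<close> keeps the values in
  [0, 1].\<close>

lemma truncated_dist_in_disc_contractions: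
  fixes x :: "'a::euclidean_space"
  assumes "c > 0" and "s > 0"
    and hyp: "\<And>y u. y \<in> ball x s \<Longrightarrow> c * norm u \<le> minimal_metric \<Omega> y u"
    and k: "0 \<le> k" "k \<le> c / 2" "k * s \<le> 1"
  shows "(\<lambda>y. k * min (dist x y) s) \<in> disc_contractions \<Omega>"
proof -
  let ?u = "\<lambda>y. k * min (dist x y) s"
  have le: "?u (f b) - ?u (f a) \<le> norm (b - a)"
    if f: "f \<in> CH unit_disc \<Omega>" and a: "norm a < 1 / 2" and b: "norm b < 1 / 2" for f a b
  proof -
    let ?\<gamma> = "\<lambda>t. f (a + of_real t * (b - a))"
    have bound: "?u (?\<gamma> T) - ?u (f a) \<le> norm (b - a)"
      if T: "0 < T" "T \<le> 1" "\<And>t. 0 \<le> t \<Longrightarrow> t < T \<Longrightarrow> dist x (?\<gamma> t) < s" for T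
    proof -
      have "dist (f a) (?\<gamma> T) \<le> 2 / c * norm (b - a)"
        using T by (intro disc_displacement[OF f a b \<open>c > 0\<close> hyp]) auto
      moreover have "min (dist x (?\<gamma> T)) s - min (dist x (f a)) s \<le> dist (f a) (?\<gamma> T)"
        using dist_triangle[of x "?\<gamma> T" "f a"] zero_le_dist[of "f a" "?\<gamma> T"] by linarith
      ultimately have "min (dist x (?\<gamma> T)) s - min (dist x (f a)) s \<le> 2 / c * norm (b - a)"
        by linarith
      then have "k * (min (dist x (?\<gamma> T)) s - min (dist x (f a)) s) \<le> k * (2 / c * norm (b - a))"
        using k(1) by (rule mult_left_mono)
      also have "\<dots> \<le> c / 2 * (2 / c * norm (b - a))"
        using k(2) \<open>c > 0\<close> by (intro mult_right_mono) auto
      finally show ?thesis using \<open>c > 0\<close> by (simp add: algebra_simps)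
    qed
    \<comment> \<open>Either the segment starts where the truncated function is maximal, or it stays
      in the ball before time 1, or it leaves; in the last case the function is maximal at the exit
      time, so the value at \<open>f b\<close> is no larger.\<close>
    consider "s \<le> dist x (f a)" | "\<forall>t\<in>{0..<1}. dist x (?\<gamma> t) < s"
      | t where "t \<in> {0..<1}" "s \<le> dist x (?\<gamma> t)" "dist x (f a) < s"
      by force
    then show ?thesis
    proof cases
      case 1
      then have "k * min (dist x (f b)) s \<le> k * min (dist x (f a)) s"
        using k(1) by (intro mult_left_mono) auto
      then show ?thesis using norm_ge_zero[of "b - a"] by linarith
    next
      case 2
      then show ?thesis using bound[of 1] by simp
    next
      case (3 t)
      have p: "norm (a + of_real r * (b - a)) < 1" if "0 \<le> r" "r \<le> 1" for r
      proof -
        have "(1 - r) *\<^sub>R a + r *\<^sub>R b \<in> ball 0 1"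
          using a b that by (intro convexD[OF convex_ball]) auto
        then show ?thesis by (simp add: scaleR_conv_of_real algebra_simps)
      qed
      have "continuous_on {0..t} ?\<gamma>"
        using p 3 by (intro continuous_on_compose2[OF C1_map_on_imp_continuous_on[OF CH_C1[OF f]]])
          (auto intro!: continuous_intros)
      from exit_time[OF this] 3 obtain T where T: "0 < T" "T \<le> t" "dist x (?\<gamma> T) = s"
        "\<And>r. 0 \<le> r \<Longrightarrow> r < T \<Longrightarrow> dist x (?\<gamma> r) < s"
        by auto
      have "?u (f b) \<le> ?u (?\<gamma> T)"
        using k(1) T(3) by (intro mult_left_mono) auto
      then show ?thesis using bound[of T] T 3 by fastforce
    qed
  qed
  have "\<bar>?u (f z) - ?u (f 0)\<bar> \<le> norm z" if "f \<in> CH unit_disc \<Omega>" "norm z < 1 / 2" for f z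
    using le[OF that(1), of 0 z] le[OF that(1), of z 0] that(2) by (auto simp: abs_le_iff)
  moreover have "0 \<le> ?u y \<and> ?u y \<le> 1" for y
  proof -
    have "?u y \<le> k * s"
      using k(1) by (intro mult_left_mono) auto
    then show ?thesis using k \<open>s > 0\<close> by simp
  qed
  ultimately show ?thesis
    unfolding disc_contractions_def by auto
qed

text \<open>The truncated distance from \<open>x\<close> is a test function that vanishes at
  \<open>x\<close> and equals \<open>k * s\<close> outside the ball, so a smaller contraction
  distance confines \<open>y\<close> to the ball.\<close>

lemma contraction_dist_separates:
  fixes x :: "'a::euclidean_space"
  assumes "hyperbolic_at \<Omega> x" and "e > 0"
  obtains r where "r > 0" "\<And>y. contraction_dist \<Omega> x y < r \<Longrightarrow> dist x y < e"
proof -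
  obtain U c where U: "open U" "x \<in> U" "c > 0" "\<And>y u. y \<in> U \<Longrightarrow> c * norm u \<le> minimal_metric \<Omega> y u"
    using assms(1) unfolding hyperbolic_at_def by blast
  obtain s0 where s0: "s0 > 0" "ball x s0 \<subseteq> U"
    using U openE by blast
  define s where "s = min s0 e"
  have s: "s > 0" "s \<le> e" "ball x s \<subseteq> U"
    using s0 \<open>e > 0\<close> by (auto simp: s_def)
  define k where "k = min (c / 2) (1 / s)"
  have k: "0 < k" "k \<le> c / 2" "k * s \<le> 1"
    using s(1) \<open>c > 0\<close> by (auto simp: k_def min_def field_simps)
  have u: "(\<lambda>y. k * min (dist x y) s) \<in> disc_contractions \<Omega>"
    using k U(3,4) s by (intro truncated_dist_in_disc_contractions) auto
  show thesis
  proof (rule that)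
    show "k * s > 0" using k s by simp
    fix y assume "contraction_dist \<Omega> x y < k * s"
    moreover have "k * min (dist x y) s \<le> contraction_dist \<Omega> x y"
      using contraction_dist_ge[OF u, of x y] s(1) k(1) by simp
    ultimately have "k * min (dist x y) s < k * s" by linarith
    then have "min (dist x y) s < s"
      using k(1) by (simp only: mult_less_cancel_left_pos)
    then have "dist x y < s"
      by simp
    then show "dist x y < e" using s(2) by simp
  qed
qed

text \<open>R-hyperbolicity enters through definiteness, by separation at the scale
  \<open>dist x y\<close>.\<close>

lemma Metric_space_contraction_dist:
  assumes "R_hyperbolic \<Omega>"
  shows "Metric_space \<Omega> (contraction_dist \<Omega>)"
proof
  fix x y
  show "0 \<le> contraction_dist \<Omega> x y"
    using contraction_dist_ge[OF const_in_disc_contractions, where x=x and y=y and \<Omega>=\<Omega>] by simp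
  show "contraction_dist \<Omega> x y = contraction_dist \<Omega> y x"
    by (simp add: contraction_dist_def abs_minus_commute)
next
  fix x y assume "x \<in> \<Omega>" "y \<in> \<Omega>"
  have "dist x y = 0" if 0: "contraction_dist \<Omega> x y = 0"
  proof (rule ccontr)
    assume "dist x y \<noteq> 0"
    then have "dist x y > 0" by simp
    moreover have "hyperbolic_at \<Omega> x"
      using assms \<open>x \<in> \<Omega>\<close> by (simp add: R_hyperbolic_def)
    ultimately show False
      using contraction_dist_separates[where e="dist x y"] 0 by (metis less_irrefl)
  qed
  moreover have "contraction_dist \<Omega> x x = 0"
    using contraction_dist_le[where x=x and y=x and \<Omega>=\<Omega> and C=0] contraction_dist_ge[OF const_in_disc_contractions, where x=x and y=x and \<Omega>=\<Omega>]
    by simp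
  ultimately show "contraction_dist \<Omega> x y = 0 \<longleftrightarrow> x = y" by auto
next
  fix x y z
  show "contraction_dist \<Omega> x z \<le> contraction_dist \<Omega> x y + contraction_dist \<Omega> y z"
  proof (rule contraction_dist_le)
    fix u assume "u \<in> disc_contractions \<Omega>"
    from contraction_dist_ge[OF this, of x y] contraction_dist_ge[OF this, of y z]
    show "\<bar>u x - u z\<bar> \<le> contraction_dist \<Omega> x y + contraction_dist \<Omega> y z" by linarith
  qed
qed

text \<open>Flat discs put a Euclidean ball inside every ball of \<open>contraction_dist\<close>,
  and \<open>contraction_dist_separates\<close> gives the reverse nesting.\<close>

lemma mtopology_contraction_dist:
  fixes \<Omega> :: "'a::euclidean_space set"
  assumes "DIM('a) \<ge> 2" and "open \<Omega>" and R: "R_hyperbolic \<Omega>"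
  shows "Metric_space.mtopology \<Omega> (contraction_dist \<Omega>) = top_of_set \<Omega>"
proof -
  interpret Metric_space \<Omega> "contraction_dist \<Omega>"
    by (rule Metric_space_contraction_dist[OF R])
  have "openin mtopology U \<longleftrightarrow> openin (top_of_set \<Omega>) U" for U
  proof
    assume U: "openin mtopology U"
    then have sub: "U \<subseteq> \<Omega>" by (simp add: openin_mtopology)
    have "open U"
      unfolding open_dist
    proof
      fix x assume "x \<in> U"
      then obtain r where r: "r > 0" "mball x r \<subseteq> U"
        using U by (auto simp: openin_mtopology)
      have "x \<in> \<Omega>" using \<open>x \<in> U\<close> sub by blast
      then obtain s where s: "s > 0" "ball x s \<subseteq> \<Omega>"
        using \<open>open \<Omega>\<close> openE by blast
      have "y \<in> U" if "dist y x < min (s / 2) (r * s)" for y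
      proof -
        have "contraction_dist \<Omega> x y \<le> dist x y / s"
          using that by (intro contraction_dist_le_flat[OF assms(1) s(2,1)]) (simp add: dist_commute)
        also have "\<dots> < r"
          using that s(1) by (simp add: dist_commute field_simps)
        finally have "contraction_dist \<Omega> x y < r" .
        moreover have "y \<in> \<Omega>"
          using that s by (intro subsetD[OF s(2)]) (auto simp: dist_commute)
        ultimately show ?thesis using r(2) \<open>x \<in> \<Omega>\<close> by (auto simp: mball_def)
      qed
      then show "\<exists>e>0. \<forall>y. dist y x < e \<longrightarrow> y \<in> U"
        using s(1) r(1) by (intro exI[of _ "min (s / 2) (r * s)"]) auto
    qed
    then show "openin (top_of_set \<Omega>) U"
      using sub \<open>open \<Omega>\<close> by (simp add: openin_open_eq)
  next
    assume "openin (top_of_set \<Omega>) U"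
    then have U: "open U" "U \<subseteq> \<Omega>"
      using \<open>open \<Omega>\<close> by (auto simp: openin_open_eq)
    show "openin mtopology U"
      unfolding openin_mtopology
    proof (intro conjI allI impI)
      fix x assume "x \<in> U"
      then obtain e where e: "e > 0" "ball x e \<subseteq> U"
        using U openE by blast
      have "hyperbolic_at \<Omega> x"
        using R U \<open>x \<in> U\<close> by (auto simp: R_hyperbolic_def)
      then obtain r where "r > 0" "\<And>y. contraction_dist \<Omega> x y < r \<Longrightarrow> dist x y < e"
        using contraction_dist_separates e(1) by blast
      then show "\<exists>r>0. mball x r \<subseteq> U"
        using e(2) by (intro exI[of _ r]) (auto simp: mball_def)
    qed (rule U)
  qed
  then show ?thesis by (simp add: topology_eq)
qed

lemma contraction_dist_equicontinuous:
  "pointwise_equicontinuous_on unit_disc (contraction_dist \<Omega>) (CH unit_disc \<Omega>)"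
  unfolding pointwise_equicontinuous_on_def
proof (intro ballI allI impI)
  fix z :: complex and e :: real assume z: "z \<in> unit_disc" and "0 < e"
  define d where "d = min ((1 - norm z) / 2) (e * (1 - norm z))"
  have "d > 0"
    using z \<open>e > 0\<close> by (simp add: d_def)
  moreover have "contraction_dist \<Omega> (f z) (f w) < e" if "f \<in> CH unit_disc \<Omega>" "dist z w < d" for f w
  proof -
    have "contraction_dist \<Omega> (f z) (f w) \<le> dist z w / (1 - norm z)"
      using z that by (intro contraction_dist_disc_le) (auto simp: d_def)
    also have "\<dots> < e"
      using z that(2) by (simp add: d_def field_simps)
    finally show ?thesis .
  qed
  ultimately show "\<exists>d>0. \<forall>f\<in>CH unit_disc \<Omega>. \<forall>w\<in>unit_disc. dist z w < d \<longrightarrow> contraction_dist \<Omega> (f z) (f w) < e"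
    by blast
qed

section \<open>Even families and hyperbolicity at a point\<close>

text \<open>Half radii: \<open>W\<close> is the ball of radius r/2 about \<open>y\<close>, and on
  \<open>V\<close> every map moves by less than r/2.\<close>

lemma equicontinuous_imp_even_family:
  fixes F :: "('a::metric_space \<Rightarrow> 'b::topological_space) set"
  assumes M: "Metric_space \<Omega> \<rho>" and top: "Metric_space.mtopology \<Omega> \<rho> = top_of_set \<Omega>"
    and eq: "pointwise_equicontinuous_on S \<rho> F" and F: "\<And>f. f \<in> F \<Longrightarrow> f ` S \<subseteq> \<Omega>"
  shows "even_family (top_of_set S) (top_of_set \<Omega>) F"
proof -
  interpret Metric_space \<Omega> \<rho> by (rule M)
  show ?thesis
    unfolding even_family_def
  proof (intro ballI allI impI)
    fix x y U assume x: "x \<in> topspace (top_of_set S)" and y: "y \<in> topspace (top_of_set \<Omega>)"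
      and U: "openin (top_of_set \<Omega>) U \<and> y \<in> U"
    then obtain r where r: "r > 0" "mball y r \<subseteq> U"
      unfolding top[symmetric] openin_mtopology by blast
    obtain d where d: "d > 0" "\<And>f w. f \<in> F \<Longrightarrow> w \<in> S \<Longrightarrow> dist x w < d \<Longrightarrow> \<rho> (f x) (f w) < r / 2"
      using eq x r(1) unfolding pointwise_equicontinuous_on_def by (metis half_gt_zero topspace_euclidean_subtopology)
    show "\<exists>V W. openin (top_of_set S) V \<and> x \<in> V \<and> openin (top_of_set \<Omega>) W \<and> y \<in> W \<and> W \<subseteq> U \<and>
        (\<forall>f\<in>F. f x \<in> W \<longrightarrow> f ` V \<subseteq> U)"
    proof (intro exI conjI ballI impI)
      show "openin (top_of_set S) (S \<inter> ball x d)" by (simp add: openin_open_Int)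
      show "x \<in> S \<inter> ball x d" using x d(1) by simp
      show "openin (top_of_set \<Omega>) (mball y (r / 2))" unfolding top[symmetric] by (rule openin_mball)
      show "y \<in> mball y (r / 2)" using y r(1) by simp
      show "mball y (r / 2) \<subseteq> U"
        using r mball_subset_concentric[of "r / 2" r y] by auto
      fix f assume f: "f \<in> F" "f x \<in> mball y (r / 2)"
      show "f ` (S \<inter> ball x d) \<subseteq> U"
      proof (rule image_subsetI)
        fix w assume w: "w \<in> S \<inter> ball x d"
        have "f w \<in> \<Omega>" using F f(1) w by blast
        moreover have "\<rho> y (f w) \<le> \<rho> y (f x) + \<rho> (f x) (f w)"
          using f(2) \<open>f w \<in> \<Omega>\<close> by (intro triangle) auto
        moreover have "\<rho> (f x) (f w) < r / 2" using d(2)[OF f(1), of w] w by auto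
        ultimately have "f w \<in> mball y r" using f(2) by auto
        then show "f w \<in> U" using r(2) by blast
      qed
    qed
  qed
qed

text \<open>The scalar estimate is applied to the component of \<open>f\<close> along its
  x-derivative at 0. Values in a ball of radius 1/2 keep the oscillation of that component at most
  1.\<close>

lemma CH_gradient_bound:
  fixes f :: "complex \<Rightarrow> 'a::euclidean_space"
  assumes f: "f \<in> CH unit_disc \<Omega>" and \<delta>: "0 < \<delta>" "\<delta> \<le> 1" and im: "f ` ball 0 \<delta> \<subseteq> ball p (1/2)"
  shows "norm (dx f 0) \<le> 2 * exp 1 / \<delta>"
proof -
  \<comment> \<open>\<open>sgn\<close> of the zero vector is zero, so both facts about
    \<open>e\<close> persist when the derivative vanishes.\<close>
  define e where "e = sgn (dx f 0)"
  have e: "norm e \<le> 1" "dx f 0 \<bullet> e = norm (dx f 0)"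
    by (auto simp: e_def norm_sgn sgn_div_norm dot_square_norm power2_eq_square field_simps)
  have "(\<lambda>w. f (0 + 1 * w)) \<in> CH (ball 0 \<delta>) \<Omega>"
    using \<delta> by (intro CH_affine[OF f]) auto
  then have g: "f \<in> CH (ball 0 \<delta>) \<Omega>"
    by simp
  then have h: "harmonic_map_on (ball 0 \<delta>) (\<lambda>w. f w \<bullet> e)"
    by (intro harmonic_map_on_inner) (simp_all add: CH_def)
  note C = CH_C1[OF g]
  have "\<bar>f z \<bullet> e - f 0 \<bullet> e\<bar> \<le> 1" if "z \<in> ball 0 \<delta>" for z
  proof -
    have "\<bar>f z \<bullet> e - f 0 \<bullet> e\<bar> = \<bar>(f z - f 0) \<bullet> e\<bar>"
      by (simp add: inner_diff_left)
    also have "\<dots> \<le> norm (f z - f 0) * norm e"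
      by (rule Cauchy_Schwarz_ineq2)
    also have "\<dots> \<le> 1 * 1"
    proof (intro mult_mono)
      have "dist p (f z) < 1/2" "dist p (f 0) < 1/2"
        using im that \<delta>(1) unfolding image_subset_iff by (simp_all add: Ball_def)
      then show "norm (f z - f 0) \<le> 1"
        using dist_triangle3[of "f z" "f 0" p] by (simp add: dist_norm)
    qed (use e in auto)
    finally show ?thesis by simp
  qed
  from harmonic_gradient_bound[OF h \<delta>(1) this]
  have "\<bar>dx (\<lambda>w. f w \<bullet> e) 0\<bar> \<le> 2 * exp 1 / \<delta>" .
  then show ?thesis
    using C1_map_on_inner(2)[OF C, of 0 e] e(2) \<delta> by simp
qed

text \<open>For each competing disc the gradient bound reads
  \<open>r * norm u \<le> 2 * exp 1 / \<delta>\<close>, a lower bound on 1/r with a constant uniform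
  over \<open>W\<close>.\<close>

lemma hyperbolic_atI:
  fixes p :: "'a::euclidean_space"
  assumes "DIM('a) \<ge> 2" and "open \<Omega>" and "open W" and "p \<in> W" and "W \<subseteq> \<Omega>" and \<delta>: "0 < \<delta>" "\<delta> \<le> 1"
    and im: "\<And>f. f \<in> CH unit_disc \<Omega> \<Longrightarrow> f 0 \<in> W \<Longrightarrow> f ` ball 0 \<delta> \<subseteq> ball p (1/2)"
  shows "hyperbolic_at \<Omega> p"
  unfolding hyperbolic_at_def
proof (intro exI conjI ballI allI)
  show "\<delta> / (2 * exp 1) > 0" using \<delta> by simp
  fix x u assume x: "x \<in> W"
  show "\<delta> / (2 * exp 1) * norm u \<le> minimal_metric \<Omega> x u"
    unfolding minimal_metric_def
  proof (rule cInf_greatest[OF minimal_metric_nonempty[OF assms(1,2)]])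
    show "x \<in> \<Omega>" using x assms by blast
    fix K assume "K \<in> {1 / r |r. 0 < r \<and> (\<exists>f\<in>CH unit_disc \<Omega>. f 0 = x \<and> dx f 0 = r *\<^sub>R u)}"
    then obtain r f where r: "K = 1 / r" "r > 0" and f: "f \<in> CH unit_disc \<Omega>" "f 0 = x" "dx f 0 = r *\<^sub>R u"
      by blast
    have "norm (dx f 0) \<le> 2 * exp 1 / \<delta>"
      using CH_gradient_bound[OF f(1) \<delta> im] f x by simp
    then have "r * norm u \<le> 2 * exp 1 / \<delta>"
      using f(3) r(2) by simp
    then have "norm u \<le> 2 * exp 1 / \<delta> / r"
      by (subst pos_le_divide_eq[OF r(2)]) (simp add: mult.commute)
    then have "\<delta> / (2 * exp 1) * norm u \<le> \<delta> / (2 * exp 1) * (2 * exp 1 / \<delta> / r)"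
      using \<delta> by (intro mult_left_mono) auto
    then show "\<delta> / (2 * exp 1) * norm u \<le> K"
      using r(1) \<delta> by simp
  qed
qed (use assms in auto)

text \<open>Evenness at the centre 0, applied to the ball of radius 1/2 about \<open>p\<close>,
  supplies the radius and \<open>W\<close> for \<open>hyperbolic_atI\<close>.\<close>

lemma even_family_imp_R_hyperbolic:
  fixes \<Omega> :: "'a::euclidean_space set"
  assumes "DIM('a) \<ge> 2" and "open \<Omega>"
    and ev: "even_family (top_of_set unit_disc) (top_of_set \<Omega>) (CH unit_disc \<Omega>)"
  shows "R_hyperbolic \<Omega>"
  unfolding R_hyperbolic_def
proof
  fix p assume "p \<in> \<Omega>"
  have "openin (top_of_set \<Omega>) (\<Omega> \<inter> ball p (1/2)) \<and> p \<in> \<Omega> \<inter> ball p (1/2)"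
    using \<open>p \<in> \<Omega>\<close> by (simp add: openin_open_Int)
  moreover have "0 \<in> topspace (top_of_set unit_disc)" "p \<in> topspace (top_of_set \<Omega>)"
    using \<open>p \<in> \<Omega>\<close> by auto
  ultimately obtain V W where V: "openin (top_of_set unit_disc) V" "0 \<in> V"
    and W: "openin (top_of_set \<Omega>) W" "p \<in> W" "W \<subseteq> \<Omega> \<inter> ball p (1/2)"
    and im: "\<And>f. f \<in> CH unit_disc \<Omega> \<Longrightarrow> f 0 \<in> W \<Longrightarrow> f ` V \<subseteq> \<Omega> \<inter> ball p (1/2)"
    using ev unfolding even_family_def by meson
  have "open V" "open W"
    using V(1) W(1) \<open>open \<Omega>\<close> by (auto simp: openin_open_eq)
  then obtain d where d: "d > 0" "ball 0 d \<subseteq> V"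
    using V(2) openE by blast
  show "hyperbolic_at \<Omega> p"
  proof (rule hyperbolic_atI[OF assms(1,2) \<open>open W\<close> W(2)])
    show "W \<subseteq> \<Omega>" "0 < min d 1" "min d 1 \<le> 1"
      using W d by auto
    fix f assume f: "f \<in> CH unit_disc \<Omega>" "f 0 \<in> W"
    have "ball 0 (min d 1) \<subseteq> V"
      using d(2) by auto
    then show "f ` ball 0 (min d 1) \<subseteq> ball p (1/2)"
      using im[OF f] by blast
  qed
qed

section \<open>Bounds for the minimal pseudodistance\<close>

text \<open>
  Pointwise bounds on the integrand make it unnecessary to know that the integrand is measurable when
  paths are concatenated.
\<close>

definition speed_bounded :: "'a::euclidean_space set \<Rightarrow> real \<Rightarrow> (real \<Rightarrow> 'a) \<Rightarrow> bool" where
  "speed_bounded \<Omega> K \<gamma> \<longleftrightarrow> valid_path \<gamma> \<and> path_image \<gamma> \<subseteq> \<Omega> \<and>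
     (\<exists>S. finite S \<and> (\<forall>t\<in>{0<..<1} - S. \<exists>v. (\<gamma> has_vector_derivative v) (at t) \<and> minimal_metric \<Omega> (\<gamma> t) v \<le> K))"

lemma speed_bounded_mono:
  assumes "speed_bounded \<Omega> K \<gamma>" and "K \<le> L"
  shows "speed_bounded \<Omega> L \<gamma>"
  using assms unfolding speed_bounded_def by (meson order_trans)

text \<open>Every point of the segment has a ball of radius \<open>s\<close> around it inside
  \<open>ball p (2 * s)\<close>, so flat discs bound g along it.\<close>

lemma speed_bounded_linepath:
  fixes a b p :: "'a::euclidean_space"
  assumes "DIM('a) \<ge> 2" and sub: "ball p (2 * s) \<subseteq> \<Omega>" and "s > 0" and ab: "a \<in> ball p s" "b \<in> ball p s"
  shows "speed_bounded \<Omega> (dist a b / s) (linepath a b)"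
proof -
  have seg: "path_image (linepath a b) \<subseteq> ball p s"
    unfolding path_image_linepath using ab by (simp add: closed_segment_subset)
  have "minimal_metric \<Omega> (linepath a b t) (b - a) \<le> dist a b / s" if "t \<in> {0<..<1}" for t
  proof -
    have "linepath a b t \<in> ball p s"
      using seg that unfolding path_image_def image_subset_iff by simp
    then have "ball (linepath a b t) s \<subseteq> ball p (2 * s)"
      by (intro ball_subset_ball_iff[THEN iffD2] disjI1) (simp add: dist_commute)
    then show ?thesis
      using minimal_metric_le_flat[OF assms(1) _ \<open>s > 0\<close>, of "linepath a b t" \<Omega> "b - a"] sub
      by (simp add: dist_norm norm_minus_commute)
  qed
  moreover have "ball p s \<subseteq> ball p (2 * s)"
    using \<open>s > 0\<close> by auto
  ultimately show ?thesis
    using seg sub has_vector_derivative_linepath_within[of a b _ UNIV]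
    unfolding speed_bounded_def by (intro conjI exI[of _ "{}"] ballI exI[of _ "b - a"]) auto
qed

lemma speed_bounded_disc:
  fixes f :: "complex \<Rightarrow> 'a::euclidean_space"
  assumes f: "f \<in> CH unit_disc \<Omega>" and z: "norm z < 1 / 2"
  shows "speed_bounded \<Omega> (2 * norm z) (\<lambda>t. f (of_real t * z))"
proof -
  let ?D = "\<lambda>t. Re z *\<^sub>R dx f (of_real t * z) + Im z *\<^sub>R dy f (of_real t * z)"
  have n: "norm (of_real t * z) < 1 / 2" if "t \<in> {0..1}" for t
  proof -
    have "norm (of_real t * z) \<le> 1 * norm z"
      using that unfolding norm_mult by (intro mult_right_mono) auto
    then show ?thesis using z by linarith
  qed
  have der: "((\<lambda>t. f (of_real t * z)) has_vector_derivative ?D t) (at t)" if "t \<in> {0..1}" for t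
    using CH_has_vector_derivative[OF f, of 0 t z] n[OF that] by simp
  have "continuous_on unit_disc (dx f)" "continuous_on unit_disc (dy f)"
    using CH_C1[OF f] by (auto simp: C1_map_on_def)
  then have "continuous_on {0..1} (\<lambda>t. dx f (of_real t * z))" "continuous_on {0..1} (\<lambda>t. dy f (of_real t * z))"
    using n by (force intro!: continuous_on_compose2[where f="\<lambda>t. of_real t * z"] continuous_intros)+
  then have "continuous_on {0..1} ?D"
    by (intro continuous_intros)
  then have "(\<lambda>t. f (of_real t * z)) C1_differentiable_on {0..1}"
    using der unfolding C1_differentiable_on_def by (intro exI[of _ ?D]) simp
  then have "valid_path (\<lambda>t. f (of_real t * z))"
    unfolding valid_path_def by (rule C1_differentiable_imp_piecewise)
  moreover have "path_image (\<lambda>t. f (of_real t * z)) \<subseteq> \<Omega>"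
  proof -
    have "f ` unit_disc \<subseteq> \<Omega>"
      using f by (simp add: CH_def)
    then show ?thesis using n by (force simp: path_image_def)
  qed
  moreover have "minimal_metric \<Omega> (f (of_real t * z)) (?D t) \<le> 2 * norm z" if "t \<in> {0<..<1}" for t
    using that by (intro minimal_metric_disc_le[OF f n]) auto
  ultimately show ?thesis
    using der unfolding speed_bounded_def
    by (intro conjI exI[of _ "{}"] ballI) (auto intro!: exI[of _ "?D _"])
qed

text \<open>Joining runs each path at double speed, which doubles the bound by
  \<open>minimal_metric_scaleR_le\<close>.\<close>

lemma speed_bounded_join:
  fixes \<gamma>1 \<gamma>2 :: "real \<Rightarrow> 'a::euclidean_space"
  assumes "DIM('a) \<ge> 2" and "open \<Omega>"
    and 1: "speed_bounded \<Omega> K \<gamma>1" and 2: "speed_bounded \<Omega> K \<gamma>2" and eq: "pathfinish \<gamma>1 = pathstart \<gamma>2"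
  shows "speed_bounded \<Omega> (2 * K) (\<gamma>1 +++ \<gamma>2)"
proof -
  have im: "path_image \<gamma>1 \<subseteq> \<Omega>" "path_image \<gamma>2 \<subseteq> \<Omega>"
    using 1 2 by (auto simp: speed_bounded_def)
  obtain S1 where S1: "finite S1" "\<And>t. t \<in> {0<..<1} - S1 \<Longrightarrow>
      \<exists>v. (\<gamma>1 has_vector_derivative v) (at t) \<and> minimal_metric \<Omega> (\<gamma>1 t) v \<le> K"
    using 1 unfolding speed_bounded_def by blast
  obtain S2 where S2: "finite S2" "\<And>t. t \<in> {0<..<1} - S2 \<Longrightarrow>
      \<exists>v. (\<gamma>2 has_vector_derivative v) (at t) \<and> minimal_metric \<Omega> (\<gamma>2 t) v \<le> K"
    using 2 unfolding speed_bounded_def by blast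
  have twice: "minimal_metric \<Omega> x (2 *\<^sub>R v) \<le> 2 * K" if "x \<in> \<Omega>" "minimal_metric \<Omega> x v \<le> K" for x v
    using minimal_metric_scaleR_le[OF assms(1,2) that(1), of 2 v] that(2) by simp
  \<comment> \<open>The joint and the images of both exceptional sets under the
    reparametrizations.\<close>
  let ?S = "{1/2} \<union> (\<lambda>t. t / 2) ` S1 \<union> (\<lambda>t. (t + 1) / 2) ` S2"
  have "\<exists>v. (\<gamma>1 +++ \<gamma>2 has_vector_derivative v) (at t) \<and> minimal_metric \<Omega> ((\<gamma>1 +++ \<gamma>2) t) v \<le> 2 * K"
    if t: "t \<in> {0<..<1} - ?S" for t
  proof (cases "t < 1 / 2")
    case True
    have "2 * t \<in> {0<..<1} - S1"
    proof -
      have "2 * t \<notin> S1"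
      proof
        assume "2 * t \<in> S1"
        then have "2 * t / 2 \<in> ?S" by blast
        then show False using t by simp
      qed
      then show ?thesis using t True by simp
    qed
    then obtain v where v: "(\<gamma>1 has_vector_derivative v) (at (2 * t))" "minimal_metric \<Omega> (\<gamma>1 (2 * t)) v \<le> K"
      using S1(2) by blast
    have "((\<lambda>t. 2 * t) has_vector_derivative 2) (at t)"
      using DERIV_cmult_Id[of "2::real"] by (simp add: has_real_derivative_iff_has_vector_derivative)
    from vector_diff_chain_at[OF this v(1)]
    have "(\<gamma>1 +++ \<gamma>2 has_vector_derivative 2 *\<^sub>R v) (at t)"
      by (rule has_vector_derivative_transform_within_open[of _ _ _ "{..<1/2}"])
        (use True in \<open>auto simp: joinpaths_def\<close>)
    moreover have "\<gamma>1 (2 * t) \<in> \<Omega>"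
      using im(1) t True by (auto simp: path_image_def)
    ultimately show ?thesis
      using twice[OF _ v(2)] True by (auto simp: joinpaths_def)
  next
    case False
    then have gt: "1 / 2 < t" using t by auto
    have "2 * t - 1 \<in> {0<..<1} - S2"
    proof -
      have "2 * t - 1 \<notin> S2"
      proof
        assume "2 * t - 1 \<in> S2"
        then have "(2 * t - 1 + 1) / 2 \<in> ?S" by blast
        then show False using t by simp
      qed
      then show ?thesis using t gt by simp
    qed
    then obtain v where v: "(\<gamma>2 has_vector_derivative v) (at (2 * t - 1))" "minimal_metric \<Omega> (\<gamma>2 (2 * t - 1)) v \<le> K"
      using S2(2) by blast
    have "((\<lambda>t. 2 * t - 1) has_real_derivative 2) (at t)"
      by (auto intro!: derivative_eq_intros)
    then have "((\<lambda>t. 2 * t - 1) has_vector_derivative 2) (at t)"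
      by (simp add: has_real_derivative_iff_has_vector_derivative)
    from vector_diff_chain_at[OF this v(1)]
    have "(\<gamma>1 +++ \<gamma>2 has_vector_derivative 2 *\<^sub>R v) (at t)"
      by (rule has_vector_derivative_transform_within_open[of _ _ _ "{1/2<..}"])
        (use gt in \<open>auto simp: joinpaths_def\<close>)
    moreover have "\<gamma>2 (2 * t - 1) \<in> \<Omega>"
      using im(2) t gt by (auto simp: path_image_def)
    ultimately show ?thesis
      using twice[OF _ v(2)] gt by (auto simp: joinpaths_def)
  qed
  moreover have "valid_path (\<gamma>1 +++ \<gamma>2)"
    using 1 2 eq by (intro valid_path_join) (auto simp: speed_bounded_def)
  moreover have "path_image (\<gamma>1 +++ \<gamma>2) \<subseteq> \<Omega>"
    using im by (rule subset_path_image_join)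
  moreover have "finite ?S"
    using S1(1) S2(1) by simp
  ultimately show ?thesis
    unfolding speed_bounded_def by (intro conjI exI[of _ ?S] ballI) simp_all
qed

lemma minimal_dist_le:
  assumes "speed_bounded \<Omega> K \<gamma>" and "pathstart \<gamma> = x" and "pathfinish \<gamma> = y"
  shows "minimal_dist \<Omega> x y \<le> ennreal K"
proof -
  obtain S where S: "finite S" "\<And>t. t \<in> {0<..<1} - S \<Longrightarrow>
      \<exists>v. (\<gamma> has_vector_derivative v) (at t) \<and> minimal_metric \<Omega> (\<gamma> t) v \<le> K"
    using assms(1) unfolding speed_bounded_def by blast
  let ?g = "\<lambda>t. ennreal (minimal_metric \<Omega> (\<gamma> t) (vector_derivative \<gamma> (at t within {0..1})))"
  \<comment> \<open>The endpoints are added because \<open>speed_bounded\<close> speaks about the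
    open interval.\<close>
  have "S \<union> {0, 1} \<in> null_sets lborel"
    using S(1) by (intro finite_imp_null_set_lborel) auto
  then have "AE t in lborel. t \<notin> S \<union> {0, 1}"
    by (rule AE_not_in)
  then have "AE t in lborel. ?g t * indicator {0..1} t \<le> ennreal K * indicator {0..1} t"
  proof eventually_elim
    case (elim t)
    show ?case
    proof (cases "t \<in> {0..1}")
      case True
      then have "t \<in> {0<..<1} - S" using elim by auto
      then obtain v where v: "(\<gamma> has_vector_derivative v) (at t)" "minimal_metric \<Omega> (\<gamma> t) v \<le> K"
        using S(2) by blast
      have "vector_derivative \<gamma> (at t within {0..1}) = v"
        using v(1) True by (intro vector_derivative_at_within_ivl) auto
      then show ?thesis using v(2) True by (simp add: ennreal_leI)
    qed simp
  qed
  then have "(\<integral>\<^sup>+t\<in>{0..1}. ?g t \<partial>lborel) \<le> (\<integral>\<^sup>+t\<in>{0..1::real}. ennreal K \<partial>lborel)"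
    by (rule nn_integral_mono_AE)
  also have "\<dots> = ennreal K"
    by (simp add: nn_integral_cmult_indicator)
  finally have "(\<integral>\<^sup>+t\<in>{0..1}. ?g t \<partial>lborel) \<le> ennreal K" .
  moreover have "\<gamma> \<in> {\<gamma>. valid_path \<gamma> \<and> path_image \<gamma> \<subseteq> \<Omega> \<and> pathstart \<gamma> = x \<and> pathfinish \<gamma> = y}"
    using assms by (simp add: speed_bounded_def)
  ultimately show ?thesis
    unfolding minimal_dist_def by (meson INF_lower order_trans)
qed

text \<open>The path runs straight from \<open>p\<close> to \<open>f 0\<close>, through the disc to
  \<open>f z\<close>, and straight to \<open>q\<close>. Two joins each double the bound, whence the
  factor 4.\<close>

lemma minimal_dist_disc_chain_le:
  fixes p q :: "'a::euclidean_space"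
  assumes dim: "DIM('a) \<ge> 2" and "open \<Omega>" and f: "f \<in> CH unit_disc \<Omega>" and z: "norm z < 1 / 2" and "s > 0"
    and p: "ball p (2 * s) \<subseteq> \<Omega>" "f 0 \<in> ball p s" and q: "ball q (2 * s) \<subseteq> \<Omega>" "f z \<in> ball q s"
  shows "minimal_dist \<Omega> p q \<le> ennreal (4 * (dist p (f 0) / s + 2 * norm z + dist (f z) q / s))"
proof -
  let ?K = "dist p (f 0) / s + 2 * norm z + dist (f z) q / s"
  have nonneg: "dist p (f 0) / s \<ge> 0" "dist (f z) q / s \<ge> 0"
    using \<open>s > 0\<close> by auto
  have "speed_bounded \<Omega> (dist p (f 0) / s) (linepath p (f 0))"
    using p \<open>s > 0\<close> by (intro speed_bounded_linepath[OF dim]) auto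
  \<comment> \<open>The first segment meets an already joined path with bound \<open>2 * ?K\<close>,
    so its own bound is relaxed to that value.\<close>
  then have 1: "speed_bounded \<Omega> (2 * ?K) (linepath p (f 0))"
    by (rule speed_bounded_mono) (use nonneg norm_ge_zero[of z] in \<open>simp only: distrib_left; linarith\<close>)
  have 2: "speed_bounded \<Omega> ?K (\<lambda>t. f (of_real t * z))"
    by (rule speed_bounded_mono[OF speed_bounded_disc[OF f z]]) (use nonneg in linarith)
  have "speed_bounded \<Omega> (dist (f z) q / s) (linepath (f z) q)"
    using q \<open>s > 0\<close> by (intro speed_bounded_linepath[OF dim]) auto
  then have 3: "speed_bounded \<Omega> ?K (linepath (f z) q)"
    by (rule speed_bounded_mono) (use nonneg norm_ge_zero[of z] in \<open>simp only: distrib_left; linarith\<close>)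
  have ends: "pathstart (\<lambda>t. f (of_real t * z)) = f 0" "pathfinish (\<lambda>t. f (of_real t * z)) = f z"
    by (simp_all add: pathstart_def pathfinish_def)
  let ?\<gamma> = "linepath p (f 0) +++ ((\<lambda>t. f (of_real t * z)) +++ linepath (f z) q)"
  have "speed_bounded \<Omega> (2 * (2 * ?K)) ?\<gamma>"
    by (intro speed_bounded_join[OF dim \<open>open \<Omega>\<close>] 1 2 3) (simp_all add: ends)
  from minimal_dist_le[OF this, of p q] show ?thesis
    by simp
qed

lemma minimal_dist_le_flat:
  fixes x y :: "'a::euclidean_space"
  assumes "DIM('a) \<ge> 2" and "ball x (2 * s) \<subseteq> \<Omega>" and "s > 0" and "y \<in> ball x s"
  shows "minimal_dist \<Omega> x y \<le> ennreal (dist x y / s)"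
  using assms by (intro minimal_dist_le[OF speed_bounded_linepath]) auto

section \<open>Lower bounds for the lengths of paths\<close>

text \<open>The fundamental theorem of calculus with finitely many exceptional points bounds the
  displacement by the integral of the speed. \<open>D\<close>, continuous on an open set and
  extended by zero, is Borel.\<close>

lemma displacement_le_nn_integral:
  fixes \<gamma> :: "real \<Rightarrow> 'a::euclidean_space"
  assumes "finite S" and "0 \<le> T" and cont: "continuous_on {0..T} \<gamma>"
    and D: "\<And>t. t \<in> {0<..<T} - S \<Longrightarrow> (\<gamma> has_vector_derivative D t) (at t)"
    and contD: "continuous_on ({0<..<T} - S) D"
  shows "ennreal (dist (\<gamma> 0) (\<gamma> T)) \<le> (\<integral>\<^sup>+t. ennreal (norm (indicator ({0<..<T} - S) t *\<^sub>R D t)) \<partial>lborel)"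
    and "(\<lambda>t. norm (indicator ({0<..<T} - S) t *\<^sub>R D t)) \<in> borel_measurable borel"
proof -
  let ?h = "\<lambda>t. indicator ({0<..<T} - S) t *\<^sub>R D t"
  have "open ({0<..<T} - S)"
    using assms(1) by (intro open_Diff finite_imp_closed) auto
  then have "?h \<in> borel_measurable borel"
    by (intro borel_measurable_continuous_on_indicator contD) simp
  then show meas: "(\<lambda>t. norm (?h t)) \<in> borel_measurable borel"
    by measurable
  show "ennreal (dist (\<gamma> 0) (\<gamma> T)) \<le> (\<integral>\<^sup>+t. ennreal (norm (?h t)) \<partial>lborel)"
  proof (cases "(\<integral>\<^sup>+t. ennreal (norm (?h t)) \<partial>lborel) < \<infinity>")
    \<comment> \<open>The assumptions allow \<open>D\<close> to be unbounded near \<open>S\<close>,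
      so finiteness is a separate case; an infinite integral makes the claim trivial.\<close>
    case True
    have int: "(\<lambda>t. norm (?h t)) integrable_on UNIV"
      by (rule nn_integral_integrable_on[OF meas _ True]) simp
    then have int': "(\<lambda>t. norm (?h t)) integrable_on {0..T}"
      by (rule integrable_on_subinterval) simp
    have "(?h has_integral (\<gamma> T - \<gamma> 0)) {0..T}"
    proof (rule fundamental_theorem_of_calculus_interior_strong[OF assms(1,2) _ cont])
      fix t assume "t \<in> {0<..<T} - S"
      then show "(\<gamma> has_vector_derivative ?h t) (at t)"
        using D by simp
    qed
    then have "norm (\<gamma> T - \<gamma> 0) = norm (integral {0..T} ?h)" and "?h integrable_on {0..T}"
      by (auto simp: integral_unique)
    then have "norm (\<gamma> T - \<gamma> 0) \<le> integral {0..T} (\<lambda>t. norm (?h t))"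
      using Henstock_Kurzweil_Integration.integral_norm_bound_integral[OF _ int', of ?h] by simp
    also have "\<dots> \<le> integral UNIV (\<lambda>t. norm (?h t))"
      by (rule integral_subset_le[OF _ int' int]) auto
    finally have "dist (\<gamma> 0) (\<gamma> T) \<le> integral UNIV (\<lambda>t. norm (?h t))"
      by (simp add: dist_norm norm_minus_commute)
    then show ?thesis
      using nn_integral_lborel_eq_integral[OF meas _ True] by (simp add: ennreal_leI)
  qed (simp add: less_top[symmetric])
qed

text \<open>Up to its exit from the ball a path covers the Euclidean distance \<open>s\<close>, and
  there g is at least \<open>c\<close> times the Euclidean speed.\<close>

lemma minimal_dist_ge:
  fixes x y :: "'a::euclidean_space"
  assumes "c > 0" and "s > 0" and hyp: "\<And>y u. y \<in> ball x s \<Longrightarrow> c * norm u \<le> minimal_metric \<Omega> y u"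
    and "s \<le> dist x y"
  shows "ennreal (c * s) \<le> minimal_dist \<Omega> x y"
  unfolding minimal_dist_def
proof (rule INF_greatest)
  fix \<gamma> :: "real \<Rightarrow> 'a"
  assume "\<gamma> \<in> {\<gamma>. valid_path \<gamma> \<and> path_image \<gamma> \<subseteq> \<Omega> \<and> pathstart \<gamma> = x \<and> pathfinish \<gamma> = y}"
  then have valid: "valid_path \<gamma>" and ends: "\<gamma> 0 = x" "\<gamma> 1 = y"
    by (auto simp: pathstart_def pathfinish_def)
  obtain S D where "finite S" and cont: "continuous_on {0..1} \<gamma>"
    and D: "\<And>t. t \<in> {0..1} - S \<Longrightarrow> (\<gamma> has_vector_derivative D t) (at t)"
    and contD: "continuous_on ({0..1} - S) D"
    using valid unfolding valid_path_def piecewise_C1_differentiable_on_def C1_differentiable_on_def by blast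
  obtain T where T: "0 < T" "T \<le> 1" "dist x (\<gamma> T) = s" "\<And>u. 0 \<le> u \<Longrightarrow> u < T \<Longrightarrow> dist x (\<gamma> u) < s"
    using exit_time[OF cont, of x s] ends assms(2,4) by auto
  \<comment> \<open>The Euclidean speed cut off at the exit time is a Borel minorant:
    \<open>c\<close> is moved inside its integral, and monotonicity then passes to g.\<close>
  let ?A = "{0<..<T} - S"
  let ?h = "\<lambda>t. norm (indicator ?A t *\<^sub>R D t)"
  have sub: "?A \<subseteq> {0..1} - S"
    using T(2) by auto
  have "continuous_on {0..T} \<gamma>"
    using continuous_on_subset[OF cont] T(2) by simp
  note h = displacement_le_nn_integral[OF \<open>finite S\<close> _ this D continuous_on_subset[OF contD sub]]
  have *: "ennreal s \<le> (\<integral>\<^sup>+t. ennreal (?h t) \<partial>lborel)" and meas: "?h \<in> borel_measurable borel"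
    using h T sub ends by auto
  have "ennreal (c * s) = ennreal c * ennreal s"
    using \<open>c > 0\<close> \<open>s > 0\<close> by (simp add: ennreal_mult)
  also have "\<dots> \<le> ennreal c * (\<integral>\<^sup>+t. ennreal (?h t) \<partial>lborel)"
    by (rule mult_left_mono[OF *]) simp
  also have "\<dots> = (\<integral>\<^sup>+t. ennreal c * ennreal (?h t) \<partial>lborel)"
    using meas by (intro nn_integral_cmult[symmetric]) simp
  also have "\<dots> \<le> (\<integral>\<^sup>+t\<in>{0..1}. ennreal (minimal_metric \<Omega> (\<gamma> t) (vector_derivative \<gamma> (at t within {0..1}))) \<partial>lborel)"
  proof (rule nn_integral_mono)
    fix t
    show "ennreal c * ennreal (?h t) \<le>
        ennreal (minimal_metric \<Omega> (\<gamma> t) (vector_derivative \<gamma> (at t within {0..1}))) * indicator {0..1} t"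
    proof (cases "t \<in> ?A")
      case True
      then have t: "t \<in> {0..1}" "t \<in> {0..1} - S" using sub by blast+
      have "vector_derivative \<gamma> (at t within {0..1}) = D t"
        using t D[OF t(2)] by (intro vector_derivative_at_within_ivl) auto
      moreover have "c * norm (D t) \<le> minimal_metric \<Omega> (\<gamma> t) (D t)"
        using hyp T(4)[of t] True by auto
      moreover have "ennreal c * ennreal (norm (D t)) = ennreal (c * norm (D t))"
        using \<open>c > 0\<close> by (simp add: ennreal_mult)
      ultimately show ?thesis
        using t(1) True by (simp add: ennreal_leI)
    qed simp
  qed
  finally show "ennreal (c * s) \<le>
      (\<integral>\<^sup>+t\<in>{0..1}. ennreal (minimal_metric \<Omega> (\<gamma> t) (vector_derivative \<gamma> (at t within {0..1}))) \<partial>lborel)" .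
qed

section \<open>Hyperbolicity\<close>

lemma R_hyperbolic_imp_induces_topology:
  fixes \<Omega> :: "'a::euclidean_space set"
  assumes dim: "DIM('a) \<ge> 2" and "open \<Omega>" and R: "R_hyperbolic \<Omega>"
  shows "induces_topology_on \<Omega> (minimal_dist \<Omega>)"
  unfolding induces_topology_on_def
proof (intro allI iffI)
  fix U assume "openin (top_of_set \<Omega>) U"
  then have U: "open U" "U \<subseteq> \<Omega>"
    using \<open>open \<Omega>\<close> by (auto simp: openin_open_eq)
  have "\<exists>e>0. {y \<in> \<Omega>. minimal_dist \<Omega> x y < e} \<subseteq> U" if "x \<in> U" for x
  proof -
    have "hyperbolic_at \<Omega> x"
      using R U(2) that by (auto simp: R_hyperbolic_def)
    then obtain V c where V: "open V" "x \<in> V" "c > 0" "\<And>y u. y \<in> V \<Longrightarrow> c * norm u \<le> minimal_metric \<Omega> y u"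
      unfolding hyperbolic_at_def by blast
    have "open (U \<inter> V)" "x \<in> U \<inter> V"
      using U V that by auto
    then obtain s where s: "s > 0" "ball x s \<subseteq> U \<inter> V"
      using openE by blast
    have "y \<in> U" if "minimal_dist \<Omega> x y < ennreal (c * s)" for y
    proof (rule ccontr)
      assume "y \<notin> U"
      then have "s \<le> dist x y"
        using s(2) by (auto simp: not_less[symmetric])
      then have "ennreal (c * s) \<le> minimal_dist \<Omega> x y"
        using s V(4) by (intro minimal_dist_ge V(3)) auto
      then show False using that by simp
    qed
    then show ?thesis
      using s(1) \<open>c > 0\<close> by (intro exI[of _ "ennreal (c * s)"]) (auto simp: ennreal_zero_less_mult_iff)
  qed
  then show "U \<subseteq> \<Omega> \<and> (\<forall>x\<in>U. \<exists>e>0. {y \<in> \<Omega>. minimal_dist \<Omega> x y < e} \<subseteq> U)"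
    using U by blast
next
  fix U assume U: "U \<subseteq> \<Omega> \<and> (\<forall>x\<in>U. \<exists>e>0. {y \<in> \<Omega>. minimal_dist \<Omega> x y < e} \<subseteq> U)"
  have "open U"
    unfolding open_contains_ball
  proof
    fix x assume "x \<in> U"
    then obtain e where e: "e > 0" "{y \<in> \<Omega>. minimal_dist \<Omega> x y < e} \<subseteq> U"
      using U by blast
    \<comment> \<open>\<open>e\<close> is an extended real and may be infinite; a positive real
      below it is enough.\<close>
    obtain e' :: real where e': "e' > 0" "ennreal e' < e"
    proof (cases e)
      case (real r)
      with e(1) have "r > 0" by simp
      with real show thesis
        by (intro that[of "r / 2"]) (auto intro!: ennreal_lessI)
    next
      case top
      then show thesis by (intro that[of 1]) auto
    qed
    obtain s0 where s0: "s0 > 0" "ball x s0 \<subseteq> \<Omega>"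
      using \<open>open \<Omega>\<close> U \<open>x \<in> U\<close> openE by blast
    \<comment> \<open>\<open>minimal_dist_le_flat\<close> asks for a ball of twice the radius inside
      the domain.\<close>
    define s where "s = s0 / 2"
    have s: "s > 0" "ball x (2 * s) \<subseteq> \<Omega>"
      using s0 by (auto simp: s_def)
    have "y \<in> U" if y: "y \<in> ball x (min s (e' * s))" for y
    proof -
      have "minimal_dist \<Omega> x y \<le> ennreal (dist x y / s)"
        using y by (intro minimal_dist_le_flat[OF dim s(2,1)]) auto
      also have "\<dots> \<le> ennreal e'"
        using y s(1) by (intro ennreal_leI) (simp add: pos_divide_le_eq)
      also have "\<dots> < e" by (rule e'(2))
      finally have "minimal_dist \<Omega> x y < e" .
      moreover have "y \<in> \<Omega>"
        using y s by (intro subsetD[OF s(2)]) auto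
      ultimately show ?thesis using e(2) by blast
    qed
    then show "\<exists>e>0. ball x e \<subseteq> U"
      using s(1) e'(1) by (intro exI[of _ "min s (e' * s)"]) auto
  qed
  then show "openin (top_of_set \<Omega>) U"
    using U \<open>open \<Omega>\<close> by (simp add: openin_open_eq)
qed

text \<open>The complement of \<open>y\<close> is open, so some ball of the pseudodistance around
  \<open>x\<close> misses \<open>y\<close>.\<close>

lemma induces_topology_imp_hyperbolic:
  fixes \<Omega> :: "'a::euclidean_space set"
  assumes "induces_topology_on \<Omega> (minimal_dist \<Omega>)"
  shows "hyperbolic \<Omega>"
  unfolding hyperbolic_def
proof (intro ballI impI)
  fix x y assume xy: "x \<in> \<Omega>" "y \<in> \<Omega>" "x \<noteq> y"
  have "openin (top_of_set \<Omega>) (\<Omega> \<inter> - {y})"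
    by (intro openin_open_Int) auto
  moreover have "x \<in> \<Omega> \<inter> - {y}"
    using xy by simp
  ultimately obtain e where e: "e > 0" "{z \<in> \<Omega>. minimal_dist \<Omega> x z < e} \<subseteq> \<Omega> \<inter> - {y}"
    using assms unfolding induces_topology_on_def by meson
  then have "\<not> minimal_dist \<Omega> x y < e"
    using xy by blast
  then show "minimal_dist \<Omega> x y > 0"
    using e(1) by (meson less_le_trans not_less)
qed

text \<open>Cutting escaping discs at their first exit puts points on \<open>sphere p s\<close>,
  which is compact and avoids \<open>p\<close>; the limit \<open>q\<close> is therefore distinct
  from \<open>p\<close>, while chains through the discs become arbitrarily short.\<close>

lemma hyperbolic_discs_stay_close:
  fixes p :: "'a::euclidean_space"
  assumes dim: "DIM('a) \<ge> 2" and "open \<Omega>" and H: "hyperbolic \<Omega>"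
    and s: "0 < s" "s \<le> 1 / 2" "ball p (2 * s) \<subseteq> \<Omega>"
  shows "\<exists>d. 0 < d \<and> d \<le> s \<and> (\<forall>f\<in>CH unit_disc \<Omega>. f 0 \<in> ball p d \<longrightarrow> f ` ball 0 d \<subseteq> ball p s)"
proof (rule ccontr)
  assume no: "\<not> ?thesis"
  have "\<exists>f z. f \<in> CH unit_disc \<Omega> \<and> f 0 \<in> ball p (s / real (Suc n)) \<and> norm z < s / real (Suc n) \<and> f z \<in> sphere p s" for n
  proof -
    let ?d = "s / real (Suc n)"
    have d: "0 < ?d" "?d \<le> s"
      using s(1) by (auto simp: field_simps)
    then obtain f where f: "f \<in> CH unit_disc \<Omega>" "f 0 \<in> ball p ?d" "\<not> f ` ball 0 ?d \<subseteq> ball p s"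
      using no by blast
    then obtain w where w: "norm w < ?d" "s \<le> dist p (f w)"
      unfolding image_subset_iff by (auto simp del: of_nat_Suc simp: not_less)
    have "continuous_on {0..1} (\<lambda>t. f (of_real t * w))"
    proof (rule continuous_on_compose2[OF C1_map_on_imp_continuous_on[OF CH_C1[OF f(1)]]])
      have "norm (of_real t * w) < 1" if "t \<in> {0..1}" for t
      proof -
        have "norm (of_real t * w) \<le> 1 * norm w"
          using that unfolding norm_mult by (intro mult_right_mono) auto
        then show ?thesis using w(1) d(2) s(2) by linarith
      qed
      then show "(\<lambda>t. of_real t * w) ` {0..1} \<subseteq> unit_disc" by auto
    qed (intro continuous_intros)
    from exit_time[OF this, of p s] obtain t where t: "0 < t" "t \<le> 1" "dist p (f (of_real t * w)) = s"
      using f(2) w(2) d(2) by auto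
    have "norm (of_real t * w) \<le> 1 * norm w"
      using t unfolding norm_mult by (intro mult_right_mono) auto
    then have "norm (of_real t * w) < ?d"
      using w(1) by linarith
    with f t show ?thesis by auto
  qed
  then obtain F Z where F: "\<And>n. F n \<in> CH unit_disc \<Omega>" "\<And>n. F n 0 \<in> ball p (s / real (Suc n))"
    and Z: "\<And>n. norm (Z n :: complex) < s / real (Suc n)" "\<And>n. F n (Z n) \<in> sphere p s"
    by metis
  obtain q r where q: "q \<in> sphere p s" and r: "strict_mono r" "((\<lambda>n. F n (Z n)) \<circ> r) \<longlonglongrightarrow> q"
    using compact_sphere[of p s] Z(2) unfolding compact_def by meson
  have "ball q s \<subseteq> ball p (2 * s)"
    using q by (intro ball_subset_ball_iff[THEN iffD2] disjI1) (simp add: dist_commute)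
  then have ball_q: "ball q (2 * (s / 2)) \<subseteq> \<Omega>"
    using s(3) by simp
  have "ball p s \<subseteq> ball p (2 * s)"
    using s(1) by auto
  then have ball_p: "ball p (2 * (s / 2)) \<subseteq> \<Omega>"
    using s(3) by simp
  have "minimal_dist \<Omega> p q \<le> 0"
  proof (rule ennreal_le_epsilon)
    fix e :: real assume "0 < e"
    \<comment> \<open>With each leg of the chain controlled by \<open>\<delta>\<close>, the total is
      at most \<open>\<delta> * (4 * (4 / s + 2))\<close>, hence at most \<open>e\<close>. The bound
      \<open>s / 2\<close> keeps both ends of the disc segment in the balls about \<open>p\<close>
      and \<open>q\<close>.\<close>
    define \<delta> where "\<delta> = min (s / 2) (e / (4 * (4 / s + 2)))"
    have pos: "4 * (4 / s + 2) > 0"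
      using s(1) by (simp add: add_pos_pos)
    then have "\<delta> > 0"
      using s(1) \<open>0 < e\<close> by (simp add: \<delta>_def)
    obtain N where N: "\<And>n. n \<ge> N \<Longrightarrow> dist (F (r n) (Z (r n))) q < \<delta>"
      using r(2) \<open>\<delta> > 0\<close> unfolding lim_sequentially by fastforce
    obtain M where M: "s / real (Suc M) < \<delta>"
    proof -
      obtain M where "inverse (real (Suc M)) < \<delta> / s"
        using reals_Archimedean[of "\<delta> / s"] \<open>\<delta> > 0\<close> s(1) by auto
      then have "s / real (Suc M) < \<delta>"
        using s(1) by (simp add: field_simps)
      then show thesis by (rule that)
    qed
    \<comment> \<open>The index serves both purposes: convergence from \<open>N\<close> on, and
      \<open>n \<ge> M\<close> because a subsequence index dominates its argument.\<close>
    define n where "n = r (max N M)"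
    have "max N M \<le> n"
      unfolding n_def using r(1) by (rule seq_suble)
    then have "s / real (Suc n) \<le> s / real (Suc M)"
      using s(1) by (intro divide_left_mono) auto
    then have small: "s / real (Suc n) < \<delta>"
      using M by linarith
    have 1: "dist p (F n 0) < \<delta>" and 2: "norm (Z n) < \<delta>" and 3: "dist (F n (Z n)) q < \<delta>"
      using F(2)[of n] Z(1)[of n] small N[of "max N M"] by (auto simp: n_def)
    have \<delta>: "\<delta> \<le> s / 2" "\<delta> \<le> e / (4 * (4 / s + 2))"
      unfolding \<delta>_def by (rule min.cobounded1, rule min.cobounded2)
    have \<delta>': "\<delta> * (4 * (4 / s + 2)) \<le> e"
      using \<delta>(2) by (simp only: pos_le_divide_eq[OF pos])
    have "minimal_dist \<Omega> p q \<le> ennreal (4 * (dist p (F n 0) / (s / 2) + 2 * norm (Z n) + dist (F n (Z n)) q / (s / 2)))"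
      using 1 2 3 \<delta>(1) s(1,2)
      by (intro minimal_dist_disc_chain_le[OF dim \<open>open \<Omega>\<close> F(1)] ball_p ball_q) (auto simp: dist_commute)
    also have "\<dots> \<le> ennreal e"
    proof (rule ennreal_leI)
      have "dist p (F n 0) / (s / 2) \<le> \<delta> / (s / 2)" "dist (F n (Z n)) q / (s / 2) \<le> \<delta> / (s / 2)"
        using 1 3 s(1) by (intro divide_right_mono; simp)+
      then have "4 * (dist p (F n 0) / (s / 2) + 2 * norm (Z n) + dist (F n (Z n)) q / (s / 2))
          \<le> 4 * (\<delta> / (s / 2) + 2 * \<delta> + \<delta> / (s / 2))"
        using 2 by (intro mult_left_mono add_mono) simp_all
      also have "\<dots> = \<delta> * (4 * (4 / s + 2))"
        using s(1) by (simp add: field_simps)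
      finally show "4 * (dist p (F n 0) / (s / 2) + 2 * norm (Z n) + dist (F n (Z n)) q / (s / 2)) \<le> e"
        using \<delta>' by linarith
    qed
    finally show "minimal_dist \<Omega> p q \<le> 0 + ennreal e" by simp
  qed
  moreover have "p \<in> \<Omega>" "q \<in> \<Omega>" "p \<noteq> q"
    using ball_p ball_q q s(1) by (auto simp: subset_iff)
  ultimately show False
    using H unfolding hyperbolic_def by fastforce
qed

lemma hyperbolic_imp_R_hyperbolic:
  fixes \<Omega> :: "'a::euclidean_space set"
  assumes dim: "DIM('a) \<ge> 2" and "open \<Omega>" and H: "hyperbolic \<Omega>"
  shows "R_hyperbolic \<Omega>"
  unfolding R_hyperbolic_def
proof
  fix p assume "p \<in> \<Omega>"
  then obtain s0 where s0: "s0 > 0" "ball p s0 \<subseteq> \<Omega>"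
    using \<open>open \<Omega>\<close> openE by blast
  \<comment> \<open>Halving \<open>s0\<close> leaves room for \<open>ball p (2 * s)\<close>, and the
    cap 1/2 matches the radius in \<open>hyperbolic_atI\<close>.\<close>
  define s where "s = min (s0 / 2) (1 / 2)"
  have s: "0 < s" "s \<le> 1 / 2" "ball p (2 * s) \<subseteq> \<Omega>"
    using s0 by (auto simp: s_def)
  obtain d where d: "0 < d" "d \<le> s"
    "\<And>f. f \<in> CH unit_disc \<Omega> \<Longrightarrow> f 0 \<in> ball p d \<Longrightarrow> f ` ball 0 d \<subseteq> ball p s"
    using hyperbolic_discs_stay_close[OF dim \<open>open \<Omega>\<close> H s] by blast
  show "hyperbolic_at \<Omega> p"
  proof (rule hyperbolic_atI[OF dim \<open>open \<Omega>\<close>])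
    show "ball p d \<subseteq> \<Omega>"
      using d s(1) by (intro order_trans[OF subset_ball s(3)]) simp
    show "p \<in> ball p d" "0 < d" "d \<le> 1"
      using d s by auto
    fix f assume "f \<in> CH unit_disc \<Omega>" "f 0 \<in> ball p d"
    then have "f ` ball 0 d \<subseteq> ball p s"
      by (rule d(3))
    also have "\<dots> \<subseteq> ball p (1 / 2)"
      by (rule subset_ball[OF s(2)])
    finally show "f ` ball 0 d \<subseteq> ball p (1 / 2)" .
  qed simp
qed

section \<open>The two cycles of implications\<close>

theorem theorem4p2:
  fixes \<Omega> :: "(real ^ 'n) set"
  assumes "CARD('n) \<ge> 3"
    and "open \<Omega>" and "connected \<Omega>" and "\<Omega> \<noteq> {}"
  shows "((\<exists>\<rho>. Metric_space \<Omega> \<rho> \<and> Metric_space.mtopology \<Omega> \<rho> = top_of_set \<Omega> \<and>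
               pointwise_equicontinuous_on unit_disc \<rho> (CH unit_disc \<Omega>))
            \<longleftrightarrow> even_family (top_of_set unit_disc) (top_of_set \<Omega>) (CH unit_disc \<Omega>))
       \<and> (even_family (top_of_set unit_disc) (top_of_set \<Omega>) (CH unit_disc \<Omega>)
            \<longleftrightarrow> R_hyperbolic \<Omega>)
       \<and> (R_hyperbolic \<Omega> \<longleftrightarrow> hyperbolic \<Omega>)
       \<and> (hyperbolic \<Omega> \<longleftrightarrow> induces_topology_on \<Omega> (minimal_dist \<Omega>))"
    (is "(?i \<longleftrightarrow> ?ii) \<and> (?ii \<longleftrightarrow> ?iii) \<and> (?iii \<longleftrightarrow> ?iv) \<and> (?iv \<longleftrightarrow> ?v)")
proof -
  have dim: "DIM(real ^ 'n) \<ge> 2"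
    using assms(1) by simp
  have "?ii" if i: ?i
  proof -
    obtain \<rho> where "Metric_space \<Omega> \<rho>" "Metric_space.mtopology \<Omega> \<rho> = top_of_set \<Omega>"
      "pointwise_equicontinuous_on unit_disc \<rho> (CH unit_disc \<Omega>)"
      using i by blast
    then show ?thesis
      by (rule equicontinuous_imp_even_family) (simp add: CH_def)
  qed
  moreover have "?iii" if ?ii
    using even_family_imp_R_hyperbolic[OF dim assms(2) that] .
  moreover have "?i" if ?iii
    using Metric_space_contraction_dist[OF that] mtopology_contraction_dist[OF dim assms(2) that]
      contraction_dist_equicontinuous by blast
  moreover have "?v" if ?iii
    using R_hyperbolic_imp_induces_topology[OF dim assms(2) that] .
  moreover have "?iv" if ?v
    using induces_topology_imp_hyperbolic[OF that] .
  moreover have "?iii" if ?iv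
    using hyperbolic_imp_R_hyperbolic[OF dim assms(2) that] .
  ultimately show ?thesis by blast
qed

end
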